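(* Let $M$ be a surface immersed in $\mathbb{R}^4$, $m\in M$, and let $x\in T_mM$ be a unit vector. Put $b=\alpha(x,x)$, $c=\alpha(x,Jx)$, and suppose that $\det\big(c,(\nabla_x\alpha)(x,x)\big)=0$, $b\neq0$, $Jb\cdot c\neq0$ and $\kappa'\ne0$. Then the rib direction corresponding to the strong principal direction $x$ is determined by $$u=\frac{b}{\kappa^2}-\frac{\kappa'}{\kappa^3\tau}\,Jb,$$ where $\tau$ is the normal torsion of $M$ at $m$ in the direction $x$, and $\kappa$, $\kappa'$ are the values at $t=0$ of the curvature, and of the derivative of the curvature, of the geodesic of $M$ with initial velocity $x$.
   Context: $D$ denotes the directional derivative in $\mathbb{R}^4$, $g$ the first fundamental form, $N_mM$ the normal plane of $M$ at $m$, and $X=X^\top+X^\bot$ the decomposition into tangent and normal parts. The second fundamental form is $\alpha(X,Y)=(D_XY)^\bot$; with $\nabla^\top_XY=(D_XY)^\top$ and $\nabla^\bot_Xu=(D_Xu)^\bot$, its covariant derivative is $(\nabla_X\alpha)(Y,Z)=\nabla^\bot_X(\alpha(Y,Z))-\alpha(\nabla^\top_XY,Z)-\alpha(Y,\nabla^\top_XZ)$. $J$ denotes the positive rotation by 90 degrees in the plane $T_mM$ and also in the plane $N_mM$ (for chosen orientations). The determinant of two vectors in $N_mM$ is taken with respect to an orthonormal basis. Curvature: let $\gamma_x$ be the geodesic of $M$ with $\gamma_x(0)=m$, $\gamma_x'(0)=x$, and $\kappa_x(t)=\|\alpha(\gamma_x'(t),\gamma_x'(t))\|$ its curvature as a curve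 in $\mathbb{R}^4$; $\kappa=\kappa_x(0)$ and $\kappa'=\kappa_x'(0)$. Normal torsion: the intersection of $M$ (near $m$) with the affine 3-space through $m$ generated by $x$ and $N_mM$ is a curve (the normal section); the normal torsion $\tau$ in the direction $x$ is the torsion of this curve at $m$ in that 3-space, oriented so that $x\times w=Jw$ for $w\in N_mM$; torsion of a curve $\mu$ is $\frac{(\mu'\times\mu'')\cdot\mu'''}{\|\mu'\times\mu''\|^2}$. Rib directions: for $0\neq u\in\mathbb{R}^4$, let $d_{3,u}$ be the third order Taylor polynomial at $0$ of the function $y\in T_mM\mapsto \|\exp_m(y)-(m+u)\|^2-\|u\|^2$, i.e. $$d_{3,u}(y)=-2u\cdot y+y\cdot y-u\cdot \alpha(y,y)+\tfrac13\alpha(u^\top,y)\cdot\alpha(y,y)-\tfrac13 u^\bot\cdot(\nabla_y\alpha)(y,y).$$ The vector $u$ determines a rib direction at $m$ with corresponding strong principal direction $x\neq0$ if: (i) $u\in N_mM$; (ii) $g(x,\cdot)-u\cdot\alpha(x,\cdot)=0$ on $T_mM$; (iii) $d_{3,u}(x)=0$. *)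

theory Defs
  imports "HOL-Analysis.Analysis"
begin

section \<open>Smooth maps\<close>

primrec Ck_on :: "nat \<Rightarrow> ('a::real_normed_vector \<Rightarrow> 'b::real_normed_vector) \<Rightarrow> 'a set \<Rightarrow> bool" where
  "Ck_on 0 f U \<longleftrightarrow> continuous_on U f"
| "Ck_on (Suc k) f U \<longleftrightarrow>
     f differentiable_on U \<and> (\<forall>v. Ck_on k (\<lambda>p. frechet_derivative f (at p) v) U)"

text \<open>Only meant for open sets \<open>U\<close>.\<close>

definition smooth_on :: "'a::real_normed_vector set \<Rightarrow> ('a \<Rightarrow> 'b::real_normed_vector) \<Rightarrow> bool" where
  "smooth_on U f \<longleftrightarrow> (\<forall>k. Ck_on k f U)"

abbreviation vel :: "(real \<Rightarrow> 'b::real_normed_vector) \<Rightarrow> real \<Rightarrow> 'b" where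
  "vel \<mu> \<equiv> \<lambda>t. vector_derivative \<mu> (at t)"

section \<open>Immersed surfaces in four-space\<close>

text \<open>
  The surface is the space \<open>'a\<close>, immersed by \<open>\<iota>\<close>; points with equal image (self-intersections)
  are distinct points of \<open>'a\<close>. An immersion is locally a homeomorphism onto an embedded surface,
  so the smooth structure of \<open>'a\<close> is determined by \<open>\<iota>\<close>: its smooth local parametrizations are the
  homeomorphisms \<open>\<phi>\<close> from open subsets of the plane onto open subsets of \<open>'a\<close> for which
  \<open>\<iota> \<circ> \<phi>\<close> is a smooth immersion. For the same reason a curve (or vector field) is smooth as a map
  into (or on) \<open>'a\<close> iff it is continuous and its composition with \<open>\<iota>\<close> (or with all \<open>\<phi>\<close>) is smooth.
\<close>

definition local_param ::
  "('a::topological_space \<Rightarrow> real^4) \<Rightarrow> (real^2) set \<Rightarrow> (real^2 \<Rightarrow> 'a) \<Rightarrow> bool" where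
  "local_param \<iota> U \<phi> \<longleftrightarrow>
     open U \<and> open (\<phi> ` U) \<and> (\<exists>\<psi>. homeomorphism U (\<phi> ` U) \<phi> \<psi>) \<and>
     smooth_on U (\<iota> \<circ> \<phi>) \<and> (\<forall>q\<in>U. inj (frechet_derivative (\<iota> \<circ> \<phi>) (at q)))"

definition immersed_surface :: "('a::{t2_space,second_countable_topology} \<Rightarrow> real^4) \<Rightarrow> bool" where
  "immersed_surface \<iota> \<longleftrightarrow> (\<forall>p. \<exists>U \<phi>. local_param \<iota> U \<phi> \<and> p \<in> \<phi> ` U)"

definition tangent_plane :: "('a::topological_space \<Rightarrow> real^4) \<Rightarrow> 'a \<Rightarrow> (real^4) set" where
  "tangent_plane \<iota> p =
     {frechet_derivative (\<iota> \<circ> \<phi>) (at q) v | U \<phi> q v. local_param \<iota> U \<phi> \<and> q \<in> U \<and> \<phi> q = p}"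

definition normal_plane :: "('a::topological_space \<Rightarrow> real^4) \<Rightarrow> 'a \<Rightarrow> (real^4) set" where
  "normal_plane \<iota> p = orthogonal_comp (tangent_plane \<iota> p)"

definition tan_part :: "('a::topological_space \<Rightarrow> real^4) \<Rightarrow> 'a \<Rightarrow> real^4 \<Rightarrow> real^4" where
  "tan_part \<iota> p v = (THE y. y \<in> tangent_plane \<iota> p \<and> v - y \<in> normal_plane \<iota> p)"

definition nor_part :: "('a::topological_space \<Rightarrow> real^4) \<Rightarrow> 'a \<Rightarrow> real^4 \<Rightarrow> real^4" where
  "nor_part \<iota> p v = v - tan_part \<iota> p v"

text \<open>The directional derivative \<open>D\<^sub>x Y\<close> at \<open>p\<close> of an \<open>\<real>\<^sup>4\<close>-valued map \<open>Y\<close> on the surface, for \<open>x\<close> in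
  the tangent plane at \<open>p\<close>.\<close>

definition dir_deriv ::
  "('a::topological_space \<Rightarrow> real^4) \<Rightarrow> 'a \<Rightarrow> real^4 \<Rightarrow> ('a \<Rightarrow> real^4) \<Rightarrow> real^4" where
  "dir_deriv \<iota> p x Y =
     (THE z. \<exists>U \<phi> q v. local_param \<iota> U \<phi> \<and> q \<in> U \<and> \<phi> q = p \<and>
        frechet_derivative (\<iota> \<circ> \<phi>) (at q) v = x \<and>
        z = frechet_derivative (Y \<circ> \<phi>) (at q) v)"

definition tangent_field ::
  "('a::topological_space \<Rightarrow> real^4) \<Rightarrow> 'a set \<Rightarrow> ('a \<Rightarrow> real^4) \<Rightarrow> bool" where
  "tangent_field \<iota> W Y \<longleftrightarrow>
     open W \<and> (\<forall>p\<in>W. Y p \<in> tangent_plane \<iota> p) \<and>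
     (\<forall>U \<phi>. local_param \<iota> U \<phi> \<and> \<phi> ` U \<subseteq> W \<longrightarrow> smooth_on U (Y \<circ> \<phi>))"

section \<open>The second fundamental form and its covariant derivative\<close>

text \<open>Both are tensors: their values on tangent vectors at \<open>p\<close> are obtained from arbitrary extensions
  of these vectors to tangent fields near \<open>p\<close>.\<close>

definition sff :: "('a::topological_space \<Rightarrow> real^4) \<Rightarrow> 'a \<Rightarrow> real^4 \<Rightarrow> real^4 \<Rightarrow> real^4" where
  "sff \<iota> p x y =
     (THE b. \<exists>W Y. tangent_field \<iota> W Y \<and> p \<in> W \<and> Y p = y \<and>
        b = nor_part \<iota> p (dir_deriv \<iota> p x Y))"

definition cov_sff ::
  "('a::topological_space \<Rightarrow> real^4) \<Rightarrow> 'a \<Rightarrow> real^4 \<Rightarrow> real^4 \<Rightarrow> real^4 \<Rightarrow> real^4" where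
  "cov_sff \<iota> p x y z =
     (THE w. \<exists>W Y Z. tangent_field \<iota> W Y \<and> tangent_field \<iota> W Z \<and> p \<in> W \<and> Y p = y \<and> Z p = z \<and>
        w = nor_part \<iota> p (dir_deriv \<iota> p x (\<lambda>q. sff \<iota> q (Y q) (Z q)))
            - sff \<iota> p (tan_part \<iota> p (dir_deriv \<iota> p x Y)) z
            - sff \<iota> p y (tan_part \<iota> p (dir_deriv \<iota> p x Z)))"

section \<open>Rotations by 90 degrees and determinants in a plane\<close>

text \<open>On a plane \<open>V\<close> exactly two linear maps have this property, namely the positive rotations by
  90 degrees for the two orientations of \<open>V\<close>; so choosing \<open>J\<close> amounts to choosing an orientation.\<close>

definition quarter_turn_on :: "(real^4) set \<Rightarrow> (real^4 \<Rightarrow> real^4) \<Rightarrow> bool" where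
  "quarter_turn_on V J \<longleftrightarrow> (\<forall>v\<in>V. J v \<in> V \<and> norm (J v) = norm v \<and> v \<bullet> J v = 0)"

definition orthonormal_basis_of_plane :: "(real^4) set \<Rightarrow> real^4 \<Rightarrow> real^4 \<Rightarrow> bool" where
  "orthonormal_basis_of_plane V e f \<longleftrightarrow>
     norm e = 1 \<and> norm f = 1 \<and> e \<bullet> f = 0 \<and> span {e, f} = V"

definition plane_det :: "real^4 \<Rightarrow> real^4 \<Rightarrow> real^4 \<Rightarrow> real^4 \<Rightarrow> real" where
  "plane_det e f v w =
     det (vector [vector [v \<bullet> e, v \<bullet> f], vector [w \<bullet> e, w \<bullet> f]] :: real^2^2)"

section \<open>Geodesics and curvature\<close>

definition smooth_curve :: "('a::topological_space \<Rightarrow> real^4) \<Rightarrow> real set \<Rightarrow> (real \<Rightarrow> 'a) \<Rightarrow> bool" where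
  "smooth_curve \<iota> I \<gamma> \<longleftrightarrow>
     open I \<and> is_interval I \<and> continuous_on I \<gamma> \<and> smooth_on I (\<iota> \<circ> \<gamma>)"

definition geodesic :: "('a::topological_space \<Rightarrow> real^4) \<Rightarrow> real set \<Rightarrow> (real \<Rightarrow> 'a) \<Rightarrow> bool" where
  "geodesic \<iota> I \<gamma> \<longleftrightarrow>
     smooth_curve \<iota> I \<gamma> \<and> (\<forall>t\<in>I. tan_part \<iota> (\<gamma> t) (vel (vel (\<iota> \<circ> \<gamma>)) t) = 0)"

definition geodesic_curvature_fun ::
  "('a::topological_space \<Rightarrow> real^4) \<Rightarrow> (real \<Rightarrow> 'a) \<Rightarrow> real \<Rightarrow> real" where
  "geodesic_curvature_fun \<iota> \<gamma> t = norm (sff \<iota> (\<gamma> t) (vel (\<iota> \<circ> \<gamma>) t) (vel (\<iota> \<circ> \<gamma>) t))"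

section \<open>Normal torsion\<close>

definition torsion :: "(real \<Rightarrow> real^3) \<Rightarrow> real \<Rightarrow> real" where
  "torsion \<mu> t =
     (cross3 (vel \<mu> t) (vel (vel \<mu>) t) \<bullet> vel (vel (vel \<mu>)) t) /
     (norm (cross3 (vel \<mu> t) (vel (vel \<mu>) t)))\<^sup>2"

text \<open>\<open>\<mu>\<close> is a regular parametrization, with \<open>\<mu> 0 = m\<close>, of the intersection, near \<open>m\<close>, of the
  surface with the affine 3-space through \<open>m\<close> generated by \<open>x\<close> and the normal plane at \<open>m\<close>.\<close>

definition normal_section_param ::
  "('a::topological_space \<Rightarrow> real^4) \<Rightarrow> 'a \<Rightarrow> real^4 \<Rightarrow> real set \<Rightarrow> (real \<Rightarrow> 'a) \<Rightarrow> bool" where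
  "normal_section_param \<iota> m x I \<mu> \<longleftrightarrow>
     smooth_curve \<iota> I \<mu> \<and> (\<forall>t\<in>I. vel (\<iota> \<circ> \<mu>) t \<noteq> 0) \<and> 0 \<in> I \<and> \<mu> 0 = m \<and>
     (\<exists>W. open W \<and> m \<in> W \<and>
        \<mu> ` I = {p \<in> W. \<iota> p - \<iota> m \<in> span (insert x (normal_plane \<iota> m))})"

text \<open>For a unit vector \<open>w\<close> of the normal plane, \<open>(x, w, J w)\<close> is an orthonormal frame of the 3-space,
  and taking coordinates in it identifies the 3-space with \<open>\<real>\<^sup>3\<close> so that \<open>x \<times> w = J w\<close>. The torsion
  depends neither on \<open>w\<close> nor on the parametrization (not even on the sense in which the curve is
  traversed).\<close>

definition frame_coords ::
  "real^4 \<Rightarrow> real^4 \<Rightarrow> real^4 \<Rightarrow> real^4 \<Rightarrow> real^3" where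
  "frame_coords e f h v = vector [v \<bullet> e, v \<bullet> f, v \<bullet> h]"

definition is_normal_torsion ::
  "('a::topological_space \<Rightarrow> real^4) \<Rightarrow> (real^4 \<Rightarrow> real^4) \<Rightarrow> 'a \<Rightarrow> real^4 \<Rightarrow> real \<Rightarrow> bool" where
  "is_normal_torsion \<iota> J m x \<tau> \<longleftrightarrow>
     (\<exists>I \<mu> w. normal_section_param \<iota> m x I \<mu> \<and> w \<in> normal_plane \<iota> m \<and> norm w = 1 \<and>
        \<tau> = torsion (\<lambda>t. frame_coords x w (J w) (\<iota> (\<mu> t) - \<iota> m)) 0)"

section \<open>Rib directions\<close>

text \<open>The third order Taylor polynomial at \<open>0\<close> of \<open>y \<mapsto> \<parallel>exp\<^sub>m y - (m + u)\<parallel>\<^sup>2 - \<parallel>u\<parallel>\<^sup>2\<close> on the tangent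
  plane at \<open>m\<close>.\<close>

definition d3 :: "('a::topological_space \<Rightarrow> real^4) \<Rightarrow> 'a \<Rightarrow> real^4 \<Rightarrow> real^4 \<Rightarrow> real" where
  "d3 \<iota> m u y =
     - 2 * (u \<bullet> y) + y \<bullet> y - u \<bullet> sff \<iota> m y y
     + (1/3) * (sff \<iota> m (tan_part \<iota> m u) y \<bullet> sff \<iota> m y y)
     - (1/3) * (nor_part \<iota> m u \<bullet> cov_sff \<iota> m y y y)"

definition determines_rib_direction ::
  "('a::topological_space \<Rightarrow> real^4) \<Rightarrow> 'a \<Rightarrow> real^4 \<Rightarrow> real^4 \<Rightarrow> bool" where
  "determines_rib_direction \<iota> m u x \<longleftrightarrow>
     u \<noteq> 0 \<and> x \<in> tangent_plane \<iota> m \<and> x \<noteq> 0 \<and>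
     u \<in> normal_plane \<iota> m \<and>
     (\<forall>y \<in> tangent_plane \<iota> m. x \<bullet> y - u \<bullet> sff \<iota> m x y = 0) \<and>
     d3 \<iota> m u x = 0"

end

theory Submission
  imports Defs
begin

text \<open>
  Write \<open>B = (\<nabla>\<^sub>x\<alpha>)(x,x)\<close>. For a normal vector \<open>u\<close> the rib conditions become \<open>u \<bullet> b = 1\<close> and
  \<open>u \<bullet> c = 0\<close> (testing (ii) on the basis \<open>x, J x\<close> of the tangent plane), together with
  \<open>u \<bullet> B = 0\<close> (\<open>rib_direction_iff\<close>). As \<open>c \<noteq> 0\<close> and \<open>det(c,B) = 0\<close>, \<open>B = \<lambda>c\<close>, so the third condition
  follows from the second. The first two determine \<open>u\<close> in the orthogonal basis \<open>b, J b\<close> of the normal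
  plane:
  \<open>u = b/\<kappa>\<^sup>2 - ((b \<bullet> c) / (\<kappa>\<^sup>2 (J b \<bullet> c))) J b\<close>. It remains to express the quotient by curvature and
  torsion, and this comes from two third order computations along curves:
  \<open>\<kappa>' = (b \<bullet> B)/\<kappa>\<close> along the geodesic (\<open>geodesic_curvature_deriv\<close>) and \<open>\<tau> = (J b \<bullet> B)/\<kappa>\<^sup>2\<close> for the
  normal section (\<open>normal_section_torsion\<close>). With \<open>B = \<lambda>c\<close> they give
  \<open>\<kappa>'/(\<kappa>\<tau>) = (b \<bullet> c)/(J b \<bullet> c)\<close>; moreover \<open>\<kappa>' \<noteq> 0\<close> forces \<open>\<lambda> \<noteq> 0\<close> and hence \<open>\<tau> \<noteq> 0\<close>.

  Behind both computations is a description of \<open>\<alpha>\<close> and \<open>\<nabla>\<alpha>\<close> that involves neither charts nor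
  extensions of vectors. The orthogonal projection \<open>P\<close> onto the tangent planes is a smooth map on the
  surface. Differentiating \<open>Y = P Y\<close> for a tangent field \<open>Y\<close> gives \<open>(D\<^sub>xY)\<^sup>\<bottom> = (D\<^sub>xP) Y\<close>, which
  depends on the value of \<open>Y\<close> only (\<open>nor_Dir_field\<close>); so \<open>\<alpha>(x,y) = (D\<^sub>xP) y\<close>. Replacing the arguments
  by their projections extends \<open>\<alpha>\<close> to a family \<open>II\<close> of bilinear maps on the whole of \<open>\<real>\<^sup>4\<close>, and the
  product rule turns \<open>\<nabla>\<alpha>\<close> into the normal part of \<open>D II\<close> (\<open>cov_sff_eq\<close>). A curve \<open>\<sigma>\<close> on the surface
  then satisfies \<open>\<sigma>''\<^sup>\<bottom> = II(\<sigma>',\<sigma>')\<close> and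
  \<open>\<sigma>'''\<^sup>\<bottom> = (\<nabla>\<alpha>)(\<sigma>',\<sigma>',\<sigma>') + 2 II(\<sigma>',\<sigma>'') + II(\<sigma>'',\<sigma>')\<close> (\<open>nor_acceleration\<close>, \<open>nor_jerk\<close>).
\<close>

section \<open>Calculus of smooth maps\<close>

lemma Ck_on_cong:
  assumes "open U" "\<And>p. p \<in> U \<Longrightarrow> f p = g p"
  shows "Ck_on k f U \<longleftrightarrow> Ck_on k g U"
  using assms(2)
proof (induction k arbitrary: f g)
  case 0
  then show ?case by (auto cong: continuous_on_cong)
next
  case (Suc k)
  have d: "(f has_derivative F) (at p) \<longleftrightarrow> (g has_derivative F) (at p)" if "p \<in> U" for p F
    using Suc.prems that \<open>open U\<close>
    by (metis has_derivative_transform_within_open)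
  have "frechet_derivative f (at p) = frechet_derivative g (at p)" if "p \<in> U" for p
    unfolding frechet_derivative_def using d[OF that] by simp
  then have "Ck_on k (\<lambda>p. frechet_derivative f (at p) v) U \<longleftrightarrow>
      Ck_on k (\<lambda>p. frechet_derivative g (at p) v) U" for v
    by (intro Suc.IH) simp
  moreover have "f differentiable_on U \<longleftrightarrow> g differentiable_on U"
    using d by (auto simp: differentiable_on_eq_differentiable_at[OF \<open>open U\<close>] differentiable_def)
  ultimately show ?case by simp
qed

lemma Ck_on_SucI:
  assumes "open U" "\<And>p. p \<in> U \<Longrightarrow> (f has_derivative F p) (at p)"
    and "\<And>v. Ck_on k (\<lambda>p. F p v) U"
  shows "Ck_on (Suc k) f U"
proof -
  have "frechet_derivative f (at p) = F p" if "p \<in> U" for p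
    using assms(2)[OF that] by (metis frechet_derivative_at)
  then have "Ck_on k (\<lambda>p. frechet_derivative f (at p) v) U" for v
    using Ck_on_cong[OF \<open>open U\<close>, of "\<lambda>p. frechet_derivative f (at p) v" "\<lambda>p. F p v"] assms(3)
    by simp
  moreover have "f differentiable_on U"
    using assms(2)
    by (auto simp: differentiable_on_eq_differentiable_at[OF \<open>open U\<close>] differentiable_def)
  ultimately show ?thesis by simp
qed

lemma Ck_on_SucD:
  assumes "open U" "Ck_on (Suc k) f U"
  shows "p \<in> U \<Longrightarrow> (f has_derivative frechet_derivative f (at p)) (at p)"
    and "Ck_on k (\<lambda>p. frechet_derivative f (at p) v) U"
  using assms
  by (auto simp: differentiable_on_eq_differentiable_at[OF \<open>open U\<close>] frechet_derivative_works)

lemma Ck_on_decrease: "Ck_on (Suc k) f U \<Longrightarrow> Ck_on k f U"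
  by (induction k arbitrary: f) (auto simp: differentiable_imp_continuous_on)

lemma Ck_on_subset:
  assumes "Ck_on k f U" "V \<subseteq> U"
  shows "Ck_on k f V"
  using assms
  by (induction k arbitrary: f) (auto intro: continuous_on_subset differentiable_on_subset)

lemma Ck_on_const: "Ck_on k (\<lambda>p. c) U"
  by (induction k arbitrary: c) auto

lemma Ck_on_add:
  assumes "open U" "Ck_on k f U" "Ck_on k g U"
  shows "Ck_on k (\<lambda>p. f p + g p) U"
  using assms(2,3)
proof (induction k arbitrary: f g)
  case 0
  then show ?case by (simp add: continuous_on_add)
next
  case (Suc k)
  note f = Ck_on_SucD[OF \<open>open U\<close> Suc.prems(1)] and g = Ck_on_SucD[OF \<open>open U\<close> Suc.prems(2)]
  show ?case
    by (rule Ck_on_SucI[OF \<open>open U\<close> has_derivative_add[OF f(1) g(1)] Suc.IH[OF f(2) g(2)]])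
qed

lemma Ck_on_bilinear:
  assumes B: "bounded_bilinear B" and "open U" "Ck_on k f U" "Ck_on k g U"
  shows "Ck_on k (\<lambda>p. B (f p) (g p)) U"
  using assms(3,4)
proof (induction k arbitrary: f g)
  case 0
  then show ?case by (simp add: bounded_bilinear.continuous_on[OF B])
next
  case (Suc k)
  note f = Ck_on_SucD[OF \<open>open U\<close> Suc.prems(1)] and g = Ck_on_SucD[OF \<open>open U\<close> Suc.prems(2)]
  show ?case
    by (rule Ck_on_SucI[OF \<open>open U\<close> bounded_bilinear.FDERIV[OF B f(1) g(1)]
          Ck_on_add[OF \<open>open U\<close> Suc.IH[OF Ck_on_decrease[OF Suc.prems(1)] g(2)]
            Suc.IH[OF f(2) Ck_on_decrease[OF Suc.prems(2)]]]])
qed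

lemma Ck_on_inverse:
  fixes f :: "'a::real_normed_vector \<Rightarrow> real"
  assumes "open U" "Ck_on k f U" "\<And>p. p \<in> U \<Longrightarrow> f p \<noteq> 0"
  shows "Ck_on k (\<lambda>p. inverse (f p)) U"
  using assms(2)
proof (induction k)
  case 0
  then show ?case using assms(3) by (simp add: continuous_on_inverse)
next
  case (Suc k)
  show ?case
  proof (rule Ck_on_SucI[OF \<open>open U\<close>])
    show "((\<lambda>p. inverse (f p)) has_derivative
        (\<lambda>v. - (inverse (f p) * frechet_derivative f (at p) v * inverse (f p)))) (at p)"
      if "p \<in> U" for p
      by (rule Deriv.has_derivative_inverse[OF assms(3)[OF that] Ck_on_SucD(1)[OF \<open>open U\<close> Suc.prems that]])
    fix v
    have i: "Ck_on k (\<lambda>p. inverse (f p)) U"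
      by (rule Suc.IH[OF Ck_on_decrease[OF Suc.prems]])
    have "Ck_on k (\<lambda>p. (-1) * (inverse (f p) * frechet_derivative f (at p) v * inverse (f p))) U"
      by (intro Ck_on_bilinear[OF bounded_bilinear_mult \<open>open U\<close>] Ck_on_const i
          Ck_on_SucD(2)[OF \<open>open U\<close> Suc.prems])
    then show "Ck_on k (\<lambda>p. - (inverse (f p) * frechet_derivative f (at p) v * inverse (f p))) U"
      by simp
  qed
qed

lemma smooth_on_subset: "smooth_on U f \<Longrightarrow> V \<subseteq> U \<Longrightarrow> smooth_on V f"
  unfolding smooth_on_def using Ck_on_subset by blast

lemma smooth_on_cong:
  "open U \<Longrightarrow> (\<And>p. p \<in> U \<Longrightarrow> f p = g p) \<Longrightarrow> smooth_on U f \<longleftrightarrow> smooth_on U g"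
  unfolding smooth_on_def using Ck_on_cong by blast

lemma smooth_on_has_derivative:
  "open U \<Longrightarrow> smooth_on U f \<Longrightarrow> p \<in> U \<Longrightarrow> (f has_derivative frechet_derivative f (at p)) (at p)"
  unfolding smooth_on_def using Ck_on_SucD(1) by blast

lemma smooth_on_frechet_derivative:
  "open U \<Longrightarrow> smooth_on U f \<Longrightarrow> smooth_on U (\<lambda>p. frechet_derivative f (at p) v)"
  unfolding smooth_on_def using Ck_on_SucD(2) by blast

lemma smooth_on_const: "smooth_on U (\<lambda>p. c)"
  unfolding smooth_on_def by (simp add: Ck_on_const)

lemma smooth_on_add:
  "open U \<Longrightarrow> smooth_on U f \<Longrightarrow> smooth_on U g \<Longrightarrow> smooth_on U (\<lambda>p. f p + g p)"
  unfolding smooth_on_def by (simp add: Ck_on_add)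

lemma smooth_on_bilinear:
  "bounded_bilinear B \<Longrightarrow> open U \<Longrightarrow> smooth_on U f \<Longrightarrow> smooth_on U g \<Longrightarrow> smooth_on U (\<lambda>p. B (f p) (g p))"
  unfolding smooth_on_def by (simp add: Ck_on_bilinear)

lemma smooth_on_diff:
  fixes f g :: "_ \<Rightarrow> _::real_normed_vector"
  assumes "open U" "smooth_on U f" "smooth_on U g"
  shows "smooth_on U (\<lambda>p. f p - g p)"
proof -
  have "smooth_on U (\<lambda>p. f p + (-1) *\<^sub>R g p)"
    by (intro smooth_on_add smooth_on_bilinear[OF bounded_bilinear_scaleR] smooth_on_const assms)
  then show ?thesis by simp
qed

lemma smooth_on_divide:
  fixes f g :: "_ \<Rightarrow> real"
  assumes "open U" "smooth_on U f" "smooth_on U g" "\<And>p. p \<in> U \<Longrightarrow> g p \<noteq> 0"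
  shows "smooth_on U (\<lambda>p. f p / g p)"
  unfolding divide_inverse
  by (rule smooth_on_bilinear[OF bounded_bilinear_mult assms(1,2)])
    (use assms in \<open>simp add: smooth_on_def Ck_on_inverse\<close>)

lemma smooth_on_vel:
  assumes "open I" "smooth_on I \<sigma>"
  shows "t \<in> I \<Longrightarrow> (\<sigma> has_vector_derivative vel \<sigma> t) (at t)" and "smooth_on I (vel \<sigma>)"
proof -
  have d: "(\<sigma> has_vector_derivative frechet_derivative \<sigma> (at t) 1) (at t)" if "t \<in> I" for t
  proof -
    note D = smooth_on_has_derivative[OF assms that]
    have "frechet_derivative \<sigma> (at t) = (\<lambda>h. h *\<^sub>R frechet_derivative \<sigma> (at t) 1)"
    proof
      show "frechet_derivative \<sigma> (at t) h = h *\<^sub>R frechet_derivative \<sigma> (at t) 1" for h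
        using linear_cmul[OF has_derivative_linear[OF D], of h 1] by simp
    qed
    from has_derivative_eq_rhs[OF D this] show ?thesis
      unfolding has_vector_derivative_def .
  qed
  have e: "vel \<sigma> t = frechet_derivative \<sigma> (at t) 1" if "t \<in> I" for t
    by (rule vector_derivative_at[OF d[OF that]])
  show "t \<in> I \<Longrightarrow> (\<sigma> has_vector_derivative vel \<sigma> t) (at t)" using d[of t] e[of t] by simp
  show "smooth_on I (vel \<sigma>)"
    by (rule smooth_on_cong[OF assms(1) e, THEN iffD2, OF _ smooth_on_frechet_derivative[OF assms]])
qed

section \<open>Lifting curves and charts through an immersion\<close>

text \<open>
  A continuous solution \<open>h\<close> of \<open>f \<circ> h = g\<close> inherits differentiability from \<open>g\<close> at a point where the
  derivative \<open>A\<close> of \<open>f\<close> is injective: with a left inverse \<open>L\<close> of \<open>A\<close>, the increment of \<open>h\<close> is \<open>L\<close> of the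
  increment of \<open>g\<close> up to \<open>o(\<bar>h r - h s\<bar>)\<close>; absorbing this error first shows that \<open>h\<close> is Lipschitz at the
  point, and then that it is differentiable. Transition maps between charts, and the coordinates of
  curves on the surface, are such solutions.
\<close>

lemma has_derivative_lift:
  fixes f :: "'b::euclidean_space \<Rightarrow> 'c::euclidean_space" and h :: "'a::real_normed_vector \<Rightarrow> 'b"
  assumes f: "(f has_derivative A) (at (h s))" and "inj A"
    and h: "isCont h s"
    and g: "(g has_derivative G) (at s)"
    and fh: "eventually (\<lambda>r. f (h r) = g r) (nhds s)"
  shows "\<exists>H. (h has_derivative H) (at s) \<and> G = A \<circ> H"
proof -
  have "linear A" using f has_derivative_linear by blast
  then obtain L where L: "linear L" "L \<circ> A = id"
    using \<open>inj A\<close> linear_injective_left_inverse by blast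
  then have LA: "L (A v) = v" for v by (metis comp_apply id_apply)
  obtain C where C: "C > 0" "\<And>y. norm (L y) \<le> norm y * C"
    using bounded_linear.pos_bounded[OF linear_conv_bounded_linear[THEN iffD1, OF L(1)]] by blast
  have blG: "bounded_linear G" using g has_derivative_bounded_linear by blast
  obtain K where K: "K > 0" "\<And>y. norm (G y) \<le> norm y * K"
    using bounded_linear.pos_bounded[OF blG] by blast
  have fhs: "f (h s) = g s" using eventually_nhds_x_imp_x[OF fh] .
  obtain d0 where d0: "d0 > 0" "\<And>r. dist r s < d0 \<Longrightarrow> f (h r) = g r"
    using fh unfolding eventually_nhds_metric by blast
  have main: "\<exists>d>0. \<forall>r. norm (r - s) < d \<longrightarrow>
      norm (h r - h s - L (G (r - s))) \<le> C * (e * norm (r - s) + e * norm (h r - h s))"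
    if "e > 0" for e
  proof -
    obtain d1 where d1: "d1 > 0" "\<And>y. norm (y - h s) < d1 \<Longrightarrow>
        norm (f y - f (h s) - A (y - h s)) \<le> e * norm (y - h s)"
      using f \<open>e > 0\<close> unfolding has_derivative_at_alt by blast
    obtain d2 where d2: "d2 > 0" "\<And>r. norm (r - s) < d2 \<Longrightarrow>
        norm (g r - g s - G (r - s)) \<le> e * norm (r - s)"
      using g \<open>e > 0\<close> unfolding has_derivative_at_alt by blast
    obtain d3 where d3: "d3 > 0" "\<And>r. norm (r - s) < d3 \<Longrightarrow> norm (h r - h s) < d1"
      using h d1(1) unfolding continuous_at_eps_delta dist_norm by blast
    show ?thesis
    proof (intro exI[of _ "min d0 (min d2 d3)"] conjI allI impI)
      show "0 < min d0 (min d2 d3)" using d0 d2 d3 by simp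
      fix r assume r: "norm (r - s) < min d0 (min d2 d3)"
      have "f (h r) = g r" using d0(2)[of r] r by (simp add: dist_norm)
      then have "h r - h s - L (G (r - s))
          = L (g r - g s - G (r - s)) - L (f (h r) - f (h s) - A (h r - h s))"
        using fhs LA by (simp add: linear_diff[OF L(1)])
      then have "norm (h r - h s - L (G (r - s)))
          \<le> norm (L (g r - g s - G (r - s))) + norm (L (f (h r) - f (h s) - A (h r - h s)))"
        using norm_triangle_ineq4 by metis
      also have "\<dots> \<le> norm (g r - g s - G (r - s)) * C + norm (f (h r) - f (h s) - A (h r - h s)) * C"
        using C(2) add_mono by blast
      also have "\<dots> \<le> (e * norm (r - s)) * C + (e * norm (h r - h s)) * C"
        using d2(2)[of r] d1(2)[of "h r"] d3(2)[of r] r C(1)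
        by (intro add_mono mult_right_mono) auto
      finally show "norm (h r - h s - L (G (r - s))) \<le> C * (e * norm (r - s) + e * norm (h r - h s))"
        by (simp add: algebra_simps)
    qed
  qed
  \<comment> \<open>the weight \<open>1/(2C)\<close> makes the error at most half the increment of \<open>h\<close>, to be moved to the other side\<close>
  have lip: "\<exists>d>0. \<forall>r. norm (r - s) < d \<longrightarrow> norm (h r - h s) \<le> (1 + 2 * (C * K)) * norm (r - s)"
  proof -
    have "1 / (2 * C) > 0" using C(1) by simp
    from main[OF this] obtain d where d: "d > 0" "\<And>r. norm (r - s) < d \<Longrightarrow>
        norm (h r - h s - L (G (r - s))) \<le> C * (1 / (2 * C) * norm (r - s) + 1 / (2 * C) * norm (h r - h s))"
      by blast
    have "norm (h r - h s) \<le> (1 + 2 * (C * K)) * norm (r - s)" if "norm (r - s) < d" for r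
    proof -
      have "norm (h r - h s) \<le> norm (h r - h s - L (G (r - s))) + norm (L (G (r - s)))"
        by (metis diff_add_cancel norm_triangle_ineq)
      also have "\<dots> \<le> (norm (r - s) / 2 + norm (h r - h s) / 2) + norm (r - s) * K * C"
      proof (rule add_mono)
        show "norm (h r - h s - L (G (r - s))) \<le> norm (r - s) / 2 + norm (h r - h s) / 2"
          using d(2)[OF that] C(1) by (simp add: distrib_left)
        show "norm (L (G (r - s))) \<le> norm (r - s) * K * C"
          using C(2)[of "G (r - s)"] mult_right_mono[OF K(2)[of "r - s"], of C] C(1) by linarith
      qed
      finally show ?thesis by (simp add: algebra_simps)
    qed
    with d(1) show ?thesis by blast
  qed
  then obtain dl where dl: "dl > 0"
      "\<And>r. norm (r - s) < dl \<Longrightarrow> norm (h r - h s) \<le> (1 + 2 * (C * K)) * norm (r - s)"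
    by blast
  define Q where "Q = C * (2 + 2 * (C * K))"
  have "Q > 0" using C(1) K(1) by (simp add: Q_def add_pos_pos)
  have der: "(h has_derivative L \<circ> G) (at s)"
    unfolding has_derivative_at_alt
  proof (intro conjI allI impI)
    show "bounded_linear (L \<circ> G)"
      using bounded_linear_compose[OF linear_conv_bounded_linear[THEN iffD1, OF L(1)] blG]
      by (simp add: comp_def)
    fix e :: real assume "e > 0"
    then have "e / Q > 0" using \<open>Q > 0\<close> by simp
    from main[OF this] obtain d where d: "d > 0" "\<And>r. norm (r - s) < d \<Longrightarrow>
        norm (h r - h s - L (G (r - s))) \<le> C * (e / Q * norm (r - s) + e / Q * norm (h r - h s))"
      by blast
    have "norm (h r - h s - (L \<circ> G) (r - s)) \<le> e * norm (r - s)" if "norm (r - s) < min d dl" for r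
    proof -
      have "norm (h r - h s - L (G (r - s))) \<le> C * (e / Q * norm (r - s) + e / Q * norm (h r - h s))"
        using d(2) that by simp
      also have "\<dots> \<le> C * (e / Q * norm (r - s) + e / Q * ((1 + 2 * (C * K)) * norm (r - s)))"
        using dl(2)[of r] that C(1) \<open>e / Q > 0\<close> by (intro mult_left_mono add_left_mono) auto
      also have "\<dots> = (e / Q) * Q * norm (r - s)"
        unfolding Q_def by (simp only: algebra_simps) simp
      finally show ?thesis using \<open>Q > 0\<close> by simp
    qed
    then show "\<exists>d>0. \<forall>y. norm (y - s) < d \<longrightarrow> norm (h y - h s - (L \<circ> G) (y - s)) \<le> e * norm (y - s)"
      using d(1) dl(1) by (intro exI[of _ "min d dl"]) simp
  qed
  have "((f \<circ> h) has_derivative A \<circ> (L \<circ> G)) (at s)"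
    using diff_chain_at[OF der f] .
  moreover have "((f \<circ> h) has_derivative G) (at s)"
  proof -
    obtain S where "open S" "s \<in> S" "\<And>r. r \<in> S \<Longrightarrow> g r = (f \<circ> h) r"
      using fh unfolding eventually_nhds by auto
    then show ?thesis using has_derivative_transform_within_open[OF g] by blast
  qed
  ultimately have "G = A \<circ> (L \<circ> G)" using has_derivative_unique by blast
  with der show ?thesis by blast
qed

text \<open>
  The product rule for \<open>B p (Y p)\<close>, where only the maps \<open>p \<mapsto> B p y\<close> with constant \<open>y\<close> are known to be
  differentiable. Expanding \<open>y\<close> in a basis makes the derivative of the operator-valued map \<open>B\<close>
  unnecessary.
\<close>

lemma has_derivative_linear_family:
  fixes B :: "'q::real_normed_vector \<Rightarrow> 'a::euclidean_space \<Rightarrow> 'b::real_normed_vector"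
  assumes S: "open S" "q \<in> S"
    and lin: "\<And>p. p \<in> S \<Longrightarrow> linear (B p)"
    and B: "\<And>y. ((\<lambda>p. B p y) has_derivative B' y) (at q)"
    and Y: "(Y has_derivative Y') (at q)"
  shows "((\<lambda>p. B p (Y p)) has_derivative (\<lambda>v. B' (Y q) v + B q (Y' v))) (at q)"
proof -
  have ex: "B p y = (\<Sum>e\<in>Basis. (y \<bullet> e) *\<^sub>R B p e)" if "p \<in> S" for p y
    by (subst euclidean_representation[of y, symmetric])
      (simp add: linear_sum[OF lin[OF that]] linear_cmul[OF lin[OF that]])
  have B'ex: "B' y = (\<lambda>v. \<Sum>e\<in>Basis. (y \<bullet> e) *\<^sub>R B' e v)" for y
  proof (rule has_derivative_unique[OF B])
    have "((\<lambda>p. \<Sum>e\<in>Basis. (y \<bullet> e) *\<^sub>R B p e) has_derivative (\<lambda>v. \<Sum>e\<in>Basis. (y \<bullet> e) *\<^sub>R B' e v)) (at q)"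
      by (intro has_derivative_sum has_derivative_scaleR_right B)
    then show "((\<lambda>p. B p y) has_derivative (\<lambda>v. \<Sum>e\<in>Basis. (y \<bullet> e) *\<^sub>R B' e v)) (at q)"
      by (rule has_derivative_transform_within_open[OF _ S]) (simp add: ex[of _ y, symmetric])
  qed
  have "((\<lambda>p. \<Sum>e\<in>Basis. (Y p \<bullet> e) *\<^sub>R B p e) has_derivative
      (\<lambda>v. \<Sum>e\<in>Basis. (Y q \<bullet> e) *\<^sub>R B' e v + (Y' v \<bullet> e) *\<^sub>R B q e)) (at q)"
    by (intro has_derivative_sum has_derivative_scaleR has_derivative_inner_left B Y)
  then have "((\<lambda>p. B p (Y p)) has_derivative
      (\<lambda>v. \<Sum>e\<in>Basis. (Y q \<bullet> e) *\<^sub>R B' e v + (Y' v \<bullet> e) *\<^sub>R B q e)) (at q)"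
    by (rule has_derivative_transform_within_open[OF _ S]) (simp add: ex[symmetric])
  then show ?thesis
    by (simp only: sum.distrib ex[OF S(2), symmetric] B'ex[of "Y q"])
qed

lemma local_paramD:
  assumes "local_param \<iota> U \<phi>"
  shows "open U" "open (\<phi> ` U)" "continuous_on U \<phi>" "smooth_on U (\<iota> \<circ> \<phi>)"
    and "q \<in> U \<Longrightarrow> inj (frechet_derivative (\<iota> \<circ> \<phi>) (at q))"
    and "q \<in> U \<Longrightarrow> ((\<iota> \<circ> \<phi>) has_derivative frechet_derivative (\<iota> \<circ> \<phi>) (at q)) (at q)"
    and "q \<in> U \<Longrightarrow> isCont \<phi> q"
proof -
  show "open U" and "open (\<phi> ` U)" and c: "continuous_on U \<phi>" and "smooth_on U (\<iota> \<circ> \<phi>)"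
    and "q \<in> U \<Longrightarrow> inj (frechet_derivative (\<iota> \<circ> \<phi>) (at q))"
    using assms unfolding local_param_def homeomorphism_def by auto
  then show "q \<in> U \<Longrightarrow> ((\<iota> \<circ> \<phi>) has_derivative frechet_derivative (\<iota> \<circ> \<phi>) (at q)) (at q)"
    and "q \<in> U \<Longrightarrow> isCont \<phi> q"
    by (auto simp: smooth_on_has_derivative continuous_on_eq_continuous_at)
qed

lemma local_param_restrict:
  assumes \<phi>: "local_param \<iota> U \<phi>" and "open W"
  shows "local_param \<iota> (U \<inter> \<phi> -` W) \<phi>"
proof -
  note D = local_paramD[OF \<phi>]
  have o: "open (U \<inter> \<phi> -` W)"
    using continuous_open_preimage[OF D(3,1) \<open>open W\<close>] .
  have im: "\<phi> ` (U \<inter> \<phi> -` W) = \<phi> ` U \<inter> W" by auto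
  obtain \<psi> where "homeomorphism U (\<phi> ` U) \<phi> \<psi>" using \<phi> unfolding local_param_def by blast
  then have "homeomorphism (U \<inter> \<phi> -` W) (\<phi> ` (U \<inter> \<phi> -` W)) \<phi> \<psi>"
    by (rule homeomorphism_of_subsets) (auto simp: im)
  then show ?thesis
    using \<phi> o D(2) \<open>open W\<close> smooth_on_subset[OF D(4)]
    unfolding local_param_def im by auto
qed

lemma lift_to_chart:
  fixes \<iota> :: "'a::t2_space \<Rightarrow> real^4" and c :: "'n::real_normed_vector \<Rightarrow> 'a"
  assumes \<phi>: "local_param \<iota> U \<phi>" "q \<in> U" "c s = \<phi> q"
    and c: "isCont c s" "((\<iota> \<circ> c) has_derivative G) (at s)"
  shows "\<exists>h H. (h has_derivative H) (at s) \<and> h s = q \<and>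
    eventually (\<lambda>r. c r = \<phi> (h r)) (nhds s) \<and> G = frechet_derivative (\<iota> \<circ> \<phi>) (at q) \<circ> H"
proof -
  note D = local_paramD[OF \<phi>(1)]
  obtain \<psi> where \<psi>: "homeomorphism U (\<phi> ` U) \<phi> \<psi>" using \<phi> unfolding local_param_def by blast
  define h where "h = \<psi> \<circ> c"
  have hs: "h s = q" using \<psi> \<phi> by (simp add: h_def homeomorphism_apply1)
  have "isCont \<psi> (c s)"
    using homeomorphism_cont2[OF \<psi>] D(2) \<phi>(2,3) by (simp add: continuous_on_eq_continuous_at)
  then have "isCont h s" unfolding h_def by (rule continuous_at_compose[OF c(1)])
  have "eventually (\<lambda>r. c r \<in> \<phi> ` U) (nhds s)"
    using topological_tendstoD[OF c(1)[unfolded isCont_def tendsto_at_iff_tendsto_nhds] D(2)] \<phi>(2,3)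
    by simp
  then have ev: "eventually (\<lambda>r. c r = \<phi> (h r)) (nhds s)"
    by eventually_elim (simp add: h_def homeomorphism_apply2[OF \<psi>])
  have "eventually (\<lambda>r. (\<iota> \<circ> \<phi>) (h r) = (\<iota> \<circ> c) r) (nhds s)"
    using ev by eventually_elim simp
  then obtain H where "(h has_derivative H) (at s)" "G = frechet_derivative (\<iota> \<circ> \<phi>) (at q) \<circ> H"
    using has_derivative_lift[of "\<iota> \<circ> \<phi>" _ h s "\<iota> \<circ> c" G] D(5,6)[OF \<phi>(2)] hs \<open>isCont h s\<close> c(2)
    by blast
  with hs ev show ?thesis by blast
qed

text \<open>
  The transition map between two charts is differentiable, so their derivatives have the same range.
\<close>

lemma tangent_plane_eq_range:
  fixes \<iota> :: "'a::t2_space \<Rightarrow> real^4"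
  assumes \<phi>: "local_param \<iota> U \<phi>" "q \<in> U"
  shows "tangent_plane \<iota> (\<phi> q) = range (frechet_derivative (\<iota> \<circ> \<phi>) (at q))"
proof
  show "tangent_plane \<iota> (\<phi> q) \<subseteq> range (frechet_derivative (\<iota> \<circ> \<phi>) (at q))"
  proof
    fix y assume "y \<in> tangent_plane \<iota> (\<phi> q)"
    then obtain U2 \<phi>2 q2 v where 2: "local_param \<iota> U2 \<phi>2" "q2 \<in> U2" "\<phi>2 q2 = \<phi> q"
      "y = frechet_derivative (\<iota> \<circ> \<phi>2) (at q2) v"
      unfolding tangent_plane_def by blast
    then obtain H where "frechet_derivative (\<iota> \<circ> \<phi>2) (at q2) = frechet_derivative (\<iota> \<circ> \<phi>) (at q) \<circ> H"
      using lift_to_chart[OF \<phi>, of \<phi>2 q2] local_paramD(6,7)[OF 2(1,2)] by blast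
    then show "y \<in> range (frechet_derivative (\<iota> \<circ> \<phi>) (at q))" using 2(4) by simp
  qed
  show "range (frechet_derivative (\<iota> \<circ> \<phi>) (at q)) \<subseteq> tangent_plane \<iota> (\<phi> q)"
    unfolding tangent_plane_def using \<phi> by blast
qed

section \<open>Directional derivatives on the surface\<close>

text \<open>
  One chart suffices, as transition maps are differentiable.
\<close>

definition surf_differentiable ::
  "('a::t2_space \<Rightarrow> real^4) \<Rightarrow> ('a \<Rightarrow> real^4) \<Rightarrow> 'a \<Rightarrow> bool" where
  "surf_differentiable \<iota> Y p \<longleftrightarrow>
     (\<exists>U \<phi> q. local_param \<iota> U \<phi> \<and> q \<in> U \<and> \<phi> q = p \<and> (Y \<circ> \<phi>) differentiable (at q))"

lemma has_derivative_along_aux: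
  fixes \<iota> :: "'a::t2_space \<Rightarrow> real^4" and c :: "'n::real_normed_vector \<Rightarrow> 'a"
    and Y :: "'a \<Rightarrow> real^4"
  assumes \<phi>: "local_param \<iota> U \<phi>" "q \<in> U" "c s = \<phi> q"
    and Y: "(Y \<circ> \<phi>) differentiable (at q)"
    and c: "isCont c s" "((\<iota> \<circ> c) has_derivative G) (at s)"
  shows "\<exists>H. ((Y \<circ> c) has_derivative frechet_derivative (Y \<circ> \<phi>) (at q) \<circ> H) (at s) \<and>
    G = frechet_derivative (\<iota> \<circ> \<phi>) (at q) \<circ> H"
proof -
  obtain h H where h: "(h has_derivative H) (at s)" "h s = q"
      "eventually (\<lambda>r. c r = \<phi> (h r)) (nhds s)" "G = frechet_derivative (\<iota> \<circ> \<phi>) (at q) \<circ> H"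
    using lift_to_chart[OF \<phi> c] by blast
  have "((Y \<circ> \<phi>) has_derivative frechet_derivative (Y \<circ> \<phi>) (at q)) (at (h s))"
    using Y h(2) by (simp add: frechet_derivative_works)
  from diff_chain_at[OF h(1) this]
  have "(((Y \<circ> \<phi>) \<circ> h) has_derivative frechet_derivative (Y \<circ> \<phi>) (at q) \<circ> H) (at s)" .
  moreover obtain S where "open S" "s \<in> S" "\<And>r. r \<in> S \<Longrightarrow> ((Y \<circ> \<phi>) \<circ> h) r = (Y \<circ> c) r"
    using h(3) unfolding eventually_nhds by auto
  ultimately have "((Y \<circ> c) has_derivative frechet_derivative (Y \<circ> \<phi>) (at q) \<circ> H) (at s)"
    using has_derivative_transform_within_open by blast
  with h(4) show ?thesis by blast
qed

lemma dir_deriv_chart: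
  fixes \<iota> :: "'a::t2_space \<Rightarrow> real^4"
  assumes \<phi>: "local_param \<iota> U \<phi>" "q \<in> U"
    and Y: "(Y \<circ> \<phi>) differentiable (at q)"
  shows "dir_deriv \<iota> (\<phi> q) (frechet_derivative (\<iota> \<circ> \<phi>) (at q) v) Y = frechet_derivative (Y \<circ> \<phi>) (at q) v"
  unfolding dir_deriv_def
proof (rule the_equality)
  let ?A = "frechet_derivative (\<iota> \<circ> \<phi>) (at q)"
  show "\<exists>U' \<phi>' q' v'. local_param \<iota> U' \<phi>' \<and> q' \<in> U' \<and> \<phi>' q' = \<phi> q \<and>
      frechet_derivative (\<iota> \<circ> \<phi>') (at q') v' = ?A v \<and>
      frechet_derivative (Y \<circ> \<phi>) (at q) v = frechet_derivative (Y \<circ> \<phi>') (at q') v'"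
    using \<phi> by blast
  fix z
  assume "\<exists>U' \<phi>' q' v'. local_param \<iota> U' \<phi>' \<and> q' \<in> U' \<and> \<phi>' q' = \<phi> q \<and>
      frechet_derivative (\<iota> \<circ> \<phi>') (at q') v' = ?A v \<and> z = frechet_derivative (Y \<circ> \<phi>') (at q') v'"
  then obtain U' \<phi>' q' v' where 2: "local_param \<iota> U' \<phi>'" "q' \<in> U'" "\<phi>' q' = \<phi> q"
      "frechet_derivative (\<iota> \<circ> \<phi>') (at q') v' = ?A v" "z = frechet_derivative (Y \<circ> \<phi>') (at q') v'"
    by blast
  obtain H where H: "((Y \<circ> \<phi>') has_derivative frechet_derivative (Y \<circ> \<phi>) (at q) \<circ> H) (at q')"
      "frechet_derivative (\<iota> \<circ> \<phi>') (at q') = ?A \<circ> H"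
    using has_derivative_along_aux[where c = "\<phi>'" and s = q', OF \<phi> 2(3) Y] local_paramD(6,7)[OF 2(1,2)] by blast
  have "?A (H v') = ?A v" using H(2) 2(4) by simp
  then have "H v' = v" using local_paramD(5)[OF \<phi>] by (simp add: inj_eq)
  then show "z = frechet_derivative (Y \<circ> \<phi>) (at q) v"
    using frechet_derivative_at[OF H(1)] 2(5) by (metis comp_apply)
qed

text \<open>
  The chain rule for a map \<open>c\<close> into the surface; it applies alike to curves and to charts.
\<close>

lemma has_derivative_along:
  fixes \<iota> :: "'a::t2_space \<Rightarrow> real^4" and c :: "'n::real_normed_vector \<Rightarrow> 'a"
  assumes Y: "surf_differentiable \<iota> Y (c s)"
    and c: "isCont c s" "((\<iota> \<circ> c) has_derivative G) (at s)"
  shows "((Y \<circ> c) has_derivative (\<lambda>v. dir_deriv \<iota> (c s) (G v) Y)) (at s)"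
    and "G v \<in> tangent_plane \<iota> (c s)"
proof -
  obtain U \<phi> q where \<phi>: "local_param \<iota> U \<phi>" "q \<in> U" "c s = \<phi> q"
      and d: "(Y \<circ> \<phi>) differentiable (at q)"
    using Y unfolding surf_differentiable_def by metis
  obtain H where H: "((Y \<circ> c) has_derivative frechet_derivative (Y \<circ> \<phi>) (at q) \<circ> H) (at s)"
      "G = frechet_derivative (\<iota> \<circ> \<phi>) (at q) \<circ> H"
    using has_derivative_along_aux[OF \<phi> d c] by blast
  show "G v \<in> tangent_plane \<iota> (c s)"
    using H(2) \<phi> tangent_plane_eq_range[OF \<phi>(1,2)] by auto
  have "frechet_derivative (Y \<circ> \<phi>) (at q) \<circ> H = (\<lambda>v. dir_deriv \<iota> (c s) (G v) Y)"
    using dir_deriv_chart[OF \<phi>(1,2) d] H(2) \<phi>(3) by (simp add: comp_def)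
  with H(1) show "((Y \<circ> c) has_derivative (\<lambda>v. dir_deriv \<iota> (c s) (G v) Y)) (at s)" by simp
qed

section \<open>Derivatives of curves and geometry of planes\<close>

lemma has_vector_derivative_linear_family:
  fixes B :: "real \<Rightarrow> 'a::euclidean_space \<Rightarrow> 'b::real_normed_vector"
  assumes "\<And>t. linear (B t)"
    and "\<And>y. ((\<lambda>t. B t y) has_vector_derivative B' y) (at t)"
    and "(Y has_vector_derivative Y') (at t)"
  shows "((\<lambda>t. B t (Y t)) has_vector_derivative B' (Y t) + B t Y') (at t)"
  using has_derivative_linear_family[where B = B and B' = "\<lambda>y h. h *\<^sub>R B' y" and Y = Y and q = t
      and S = UNIV and Y' = "\<lambda>h. h *\<^sub>R Y'"] assms
  unfolding has_vector_derivative_def by (simp add: linear_cmul[OF assms(1)] scaleR_add_right)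

lemma vel_affine:
  assumes L: "bounded_linear L" and I: "open I" "t \<in> I"
    and \<sigma>: "(\<sigma> has_vector_derivative \<sigma>') (at t)"
    and F: "\<And>s. s \<in> I \<Longrightarrow> F s = L (\<sigma> s - k)"
  shows "vel F t = L \<sigma>'"
proof (rule vector_derivative_at)
  have "((\<lambda>s. \<sigma> s - k) has_vector_derivative \<sigma>') (at t)"
    using has_vector_derivative_diff[OF \<sigma> has_vector_derivative_const] by simp
  from bounded_linear.has_vector_derivative[OF L this]
  show "(F has_vector_derivative L \<sigma>') (at t)"
    by (rule has_vector_derivative_transform_within_open[OF _ I]) (simp add: F)
qed

lemma plane_expansion:
  fixes p q :: "'a::euclidean_space"
  assumes "dim V = 2" "p \<in> V" "q \<in> V" "p \<noteq> 0" "q \<noteq> 0" "p \<bullet> q = 0" "v \<in> V"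
  shows "(v \<bullet> p / (p \<bullet> p)) *\<^sub>R p + (v \<bullet> q / (q \<bullet> q)) *\<^sub>R q = v"
proof -
  have "p \<noteq> q" using assms(4,6) by auto
  then have "independent {p, q}"
    using assms(4-6) by (intro pairwise_orthogonal_independent) (auto simp: pairwise_def orthogonal_def inner_commute)
  then have "V \<subseteq> span {p, q}"
    using assms(1-3) \<open>p \<noteq> q\<close> by (intro card_ge_dim_independent) auto
  then obtain s where "v - s *\<^sub>R p \<in> span {q}"
    using assms(7) span_breakdown_eq[of v p "{q}"] by blast
  then obtain t where "v - s *\<^sub>R p - t *\<^sub>R q \<in> span {}"
    using span_breakdown_eq[of "v - s *\<^sub>R p" q "{}"] by blast
  then have v: "v = s *\<^sub>R p + t *\<^sub>R q" by (simp add: algebra_simps)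
  have "v \<bullet> p = s * (p \<bullet> p)" "v \<bullet> q = t * (q \<bullet> q)"
    unfolding v using assms(6) by (simp_all add: inner_add_left inner_commute[of q p])
  then show ?thesis using assms(4,5) by (simp add: v)
qed

lemma plane_det_0_imp_parallel:
  assumes V: "dim V = 2" "orthonormal_basis_of_plane V e f"
    and vw: "v \<in> V" "w \<in> V" "v \<noteq> 0" "plane_det e f v w = 0"
  obtains k where "w = k *\<^sub>R v"
proof -
  have ef: "e \<in> V" "f \<in> V" "norm e = 1" "norm f = 1" "e \<bullet> f = 0"
    using V(2) span_base[of _ "{e, f}"] unfolding orthonormal_basis_of_plane_def by auto
  then have n: "e \<bullet> e = 1" "f \<bullet> f = 1" "e \<noteq> 0" "f \<noteq> 0" by (auto simp: dot_square_norm)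
  have exp: "(y \<bullet> e) *\<^sub>R e + (y \<bullet> f) *\<^sub>R f = y" if "y \<in> V" for y
    using plane_expansion[OF V(1) ef(1,2) n(3,4) ef(5) that] by (simp add: n)
  have par: "w = k *\<^sub>R v" if "w \<bullet> e = k * (v \<bullet> e)" "w \<bullet> f = k * (v \<bullet> f)" for k
    using exp[OF vw(2)] arg_cong[OF exp[OF vw(1)], of "scaleR k"] that by (simp add: scaleR_add_right)
  have det: "(v \<bullet> e) * (w \<bullet> f) = (v \<bullet> f) * (w \<bullet> e)"
    using vw(4) by (simp add: plane_det_def det_2)
  have "v \<bullet> e \<noteq> 0 \<or> v \<bullet> f \<noteq> 0"
    using exp[OF vw(1)] vw(3) by (metis add_0 scaleR_zero_left)
  then show thesis
  proof
    assume "v \<bullet> e \<noteq> 0"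
    then show thesis using det by (intro that[OF par[of "(w \<bullet> e) / (v \<bullet> e)"]]) (simp_all add: field_simps)
  next
    assume "v \<bullet> f \<noteq> 0"
    then show thesis using det by (intro that[OF par[of "(w \<bullet> f) / (v \<bullet> f)"]]) (simp_all add: field_simps)
  qed
qed

lemma quarter_turn_square:
  assumes J: "linear J" "quarter_turn_on V J" and V: "subspace V" "dim V = 2"
    and w: "w \<in> V" "norm w = 1"
  shows "J (J w) = - w"
proof -
  have in_V: "J v \<in> V" and len: "norm (J v) = norm v" and perp: "v \<bullet> J v = 0" if "v \<in> V" for v
    using J(2) that unfolding quarter_turn_on_def by blast+
  \<comment> \<open>polarisation: \<open>v \<bullet> J v = 0\<close> makes \<open>J\<close> skew-symmetric on \<open>V\<close>\<close>
  have "(w + J w) \<bullet> J (w + J w) = 0"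
    using perp subspace_add[OF V(1) w(1) in_V[OF w(1)]] by blast
  then have "w \<bullet> J (J w) + J w \<bullet> J w = 0"
    using perp[OF w(1)] perp[OF in_V[OF w(1)]]
    by (simp add: linear_add[OF J(1)] inner_add_left inner_add_right)
  moreover have "J w \<bullet> J w = 1" using len[OF w(1)] w(2) by (simp add: dot_square_norm)
  ultimately have "w \<bullet> J (J w) = - 1" by simp
  moreover have "J (J w) = (J (J w) \<bullet> w / (w \<bullet> w)) *\<^sub>R w + (J (J w) \<bullet> J w / (J w \<bullet> J w)) *\<^sub>R J w"
    using w len[OF w(1)] perp[OF w(1)] by (intro plane_expansion[OF V(2), symmetric] in_V) auto
  moreover have "w \<bullet> w = 1" using w(2) by (simp add: dot_square_norm)
  ultimately show ?thesis
    using perp[OF in_V[OF w(1)]] by (simp add: inner_commute)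
qed

lemma bounded_linear_frame_coords: "bounded_linear (frame_coords e f h)"
  unfolding linear_conv_bounded_linear[symmetric]
  by (rule linearI) (simp_all add: frame_coords_def vec_eq_iff forall_3 inner_add_left)

section \<open>Tangent and normal parts\<close>

lemma tangent_plane_subspace:
  fixes \<iota> :: "'a::{t2_space,second_countable_topology} \<Rightarrow> real^4"
  assumes "immersed_surface \<iota>"
  shows "subspace (tangent_plane \<iota> p)" and "dim (tangent_plane \<iota> p) = 2"
proof -
  obtain U \<phi> q where \<phi>: "local_param \<iota> U \<phi>" "q \<in> U" "p = \<phi> q"
    using assms unfolding immersed_surface_def by blast
  note D = local_paramD[OF \<phi>(1)]
  let ?A = "frechet_derivative (\<iota> \<circ> \<phi>) (at q)"
  have A: "linear ?A" using D(6)[OF \<phi>(2)] has_derivative_linear by blast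
  have T: "tangent_plane \<iota> p = range ?A" using tangent_plane_eq_range[OF \<phi>(1,2)] \<phi>(3) by simp
  show "subspace (tangent_plane \<iota> p)"
    unfolding T using linear_subspace_image[OF A subspace_UNIV] .
  show "dim (tangent_plane \<iota> p) = 2"
    unfolding T using dim_image_eq[OF A, of UNIV] D(5)[OF \<phi>(2)] by simp
qed

lemma normal_plane_iff: "v \<in> normal_plane \<iota> p \<longleftrightarrow> (\<forall>y\<in>tangent_plane \<iota> p. y \<bullet> v = 0)"
  by (auto simp: normal_plane_def orthogonal_comp_def orthogonal_def)

text \<open>
  A tangent part is determined by its two defining properties because a vector that is tangent and
  normal is orthogonal to itself.
\<close>

lemma tan_part_eqI:
  assumes T: "subspace (tangent_plane \<iota> p)"
    and y: "y \<in> tangent_plane \<iota> p" "v - y \<in> normal_plane \<iota> p"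
  shows "tan_part \<iota> p v = y"
  unfolding tan_part_def
proof (rule the_equality)
  show "y \<in> tangent_plane \<iota> p \<and> v - y \<in> normal_plane \<iota> p" using y by simp
  fix z assume z: "z \<in> tangent_plane \<iota> p \<and> v - z \<in> normal_plane \<iota> p"
  then have "y - z \<in> tangent_plane \<iota> p" using subspace_diff[OF T] y by blast
  then have "(y - z) \<bullet> (v - z) = 0" "(y - z) \<bullet> (v - y) = 0"
    using z y(2) unfolding normal_plane_iff by blast+
  then have "(y - z) \<bullet> (y - z) = 0" by (simp add: inner_diff_right)
  then show "z = y" by simp
qed

locale surface =
  fixes \<iota> :: "'a::{t2_space,second_countable_topology} \<Rightarrow> real^4"
  assumes imm: "immersed_surface \<iota>"
begin

abbreviation "T \<equiv> tangent_plane \<iota>"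
abbreviation "N \<equiv> normal_plane \<iota>"
abbreviation "tng \<equiv> tan_part \<iota>"
abbreviation "nor \<equiv> nor_part \<iota>"
abbreviation "Dir \<equiv> dir_deriv \<iota>"

lemmas subspace_T = tangent_plane_subspace(1)[OF imm]
lemmas tan_part_unique = tan_part_eqI[OF subspace_T]

lemma subspace_N: "subspace (N p)"
  unfolding normal_plane_def by (rule subspace_orthogonal_comp)

lemma T_N_orthogonal: "y \<in> T p \<Longrightarrow> v \<in> N p \<Longrightarrow> y \<bullet> v = 0"
  by (simp add: normal_plane_iff)

lemma tan_in: "tng p v \<in> T p" and nor_in: "nor p v \<in> N p"
proof -
  obtain y z where "y \<in> span (T p)" "\<And>w. w \<in> span (T p) \<Longrightarrow> orthogonal z w" "v = y + z"
    using orthogonal_subspace_decomp_exists by blast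
  then have y: "y \<in> T p" "v - y \<in> N p"
    using subspace_T[of p] by (auto simp: span_eq_iff[THEN iffD2] normal_plane_iff orthogonal_def inner_commute)
  with tan_part_unique[OF y] show "tng p v \<in> T p" "nor p v \<in> N p" by (simp_all add: nor_part_def)
qed

lemma inner_nor_part: "z \<in> N p \<Longrightarrow> nor p y \<bullet> z = y \<bullet> z"
  using T_N_orthogonal[OF tan_in] by (simp add: nor_part_def inner_diff_left)

lemma inner_tan_part: "z \<in> T p \<Longrightarrow> z \<bullet> tng p y = z \<bullet> y"
  using T_N_orthogonal[OF _ nor_in, of z p y] by (simp add: nor_part_def inner_diff_right)

lemma tan_id: "y \<in> T p \<Longrightarrow> tng p y = y"
  by (rule tan_part_unique) (auto simp: subspace_0[OF subspace_N])

lemma tan_tan [simp]: "tng p (tng p y) = tng p y"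
  by (rule tan_id[OF tan_in])

lemma tan_normal: "v \<in> N p \<Longrightarrow> tng p v = 0"
  by (rule tan_part_unique) (auto simp: subspace_0[OF subspace_T])

lemma linear_tan: "linear (tng p)"
proof (rule linearI)
  show "tng p (v + w) = tng p v + tng p w" for v w
  proof (rule tan_part_unique)
    show "tng p v + tng p w \<in> T p" by (rule subspace_add[OF subspace_T tan_in tan_in])
    have "v + w - (tng p v + tng p w) = nor p v + nor p w" by (simp add: nor_part_def)
    then show "v + w - (tng p v + tng p w) \<in> N p"
      using subspace_add[OF subspace_N nor_in nor_in, of p v w] by (simp only:)
  qed
  show "tng p (r *\<^sub>R v) = r *\<^sub>R tng p v" for r v
  proof (rule tan_part_unique)
    show "r *\<^sub>R tng p v \<in> T p" by (rule subspace_scale[OF subspace_T tan_in])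
    have "r *\<^sub>R v - r *\<^sub>R tng p v = r *\<^sub>R nor p v" by (simp add: nor_part_def scaleR_diff_right)
    then show "r *\<^sub>R v - r *\<^sub>R tng p v \<in> N p"
      using subspace_scale[OF subspace_N nor_in, of r p v] by (simp only:)
  qed
qed

lemma linear_nor: "linear (nor p)"
  unfolding nor_part_def[abs_def] by (intro linear_compose_sub linear_id[unfolded id_def] linear_tan)

lemma nor_id: "v \<in> N p \<Longrightarrow> nor p v = v"
  by (simp add: nor_part_def tan_normal)

lemma nor_tangent: "v \<in> T p \<Longrightarrow> nor p v = 0"
  by (simp add: nor_part_def tan_id)

lemma exists_chart: "\<exists>U \<phi> q. local_param \<iota> U \<phi> \<and> q \<in> U \<and> \<phi> q = p"
  using imm unfolding immersed_surface_def by (metis imageE)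

text \<open>
  In the basis \<open>u, v\<close> of the tangent plane given by a chart, the coordinates of the orthogonal projection
  solve a linear system with the Gram matrix of \<open>u, v\<close>. Cramer's rule shows that they are smooth.
\<close>

lemma tan_chart:
  assumes \<phi>: "local_param \<iota> U \<phi>"
  shows "\<exists>a b. (\<forall>q\<in>U. tng (\<phi> q) y = a q *\<^sub>R frechet_derivative (\<iota> \<circ> \<phi>) (at q) (axis 1 1)
      + b q *\<^sub>R frechet_derivative (\<iota> \<circ> \<phi>) (at q) (axis 2 1)) \<and> smooth_on U a \<and> smooth_on U b"
proof -
  note D = local_paramD[OF \<phi>]
  let ?A = "\<lambda>q. frechet_derivative (\<iota> \<circ> \<phi>) (at q)"
  define u v where "u q = ?A q (axis 1 1)" and "v q = ?A q (axis 2 1)" for q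
  define \<Delta> where "\<Delta> q = (u q \<bullet> u q) * (v q \<bullet> v q) - (u q \<bullet> v q) * (u q \<bullet> v q)" for q
  define a where "a q = ((v q \<bullet> v q) * (u q \<bullet> y) - (u q \<bullet> v q) * (v q \<bullet> y)) / \<Delta> q" for q
  define b where "b q = ((u q \<bullet> u q) * (v q \<bullet> y) - (u q \<bullet> v q) * (u q \<bullet> y)) / \<Delta> q" for q
  have lin: "linear (?A q)" if "q \<in> U" for q
    using D(6)[OF that] has_derivative_linear by blast
  have comb: "?A q w = (w $ 1) *\<^sub>R u q + (w $ 2) *\<^sub>R v q" if "q \<in> U" for q w
  proof -
    have "w = (w $ 1) *\<^sub>R axis 1 1 + (w $ 2) *\<^sub>R axis 2 1"
      by (simp add: vec_eq_iff forall_2 axis_def)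
    then have "?A q w = ?A q ((w $ 1) *\<^sub>R axis 1 1 + (w $ 2) *\<^sub>R axis 2 1)" by simp
    then show ?thesis using lin[OF that] by (simp add: linear_add linear_cmul u_def v_def)
  qed
  \<comment> \<open>\<open>\<Delta>\<close> is the Gram determinant; if it vanishes, so does \<open>(v \<bullet> v) u - (u \<bullet> v) v\<close>\<close>
  have nz: "\<Delta> q \<noteq> 0" if q: "q \<in> U" for q
  proof
    assume "\<Delta> q = 0"
    let ?w = "(v q \<bullet> v q) *\<^sub>R axis 1 1 - (u q \<bullet> v q) *\<^sub>R axis 2 1 :: real^2"
    have Aw: "?A q ?w = (v q \<bullet> v q) *\<^sub>R u q - (u q \<bullet> v q) *\<^sub>R v q"
      by (simp add: comb[OF q] axis_def)
    have "?A q ?w \<bullet> ?A q ?w = (v q \<bullet> v q) * \<Delta> q"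
      unfolding Aw \<Delta>_def by (simp add: inner_diff_left inner_diff_right inner_commute[of "v q" "u q"] algebra_simps)
    then have "?A q ?w = ?A q 0" using \<open>\<Delta> q = 0\<close> lin[OF q] by (simp add: linear_0)
    then have "?w = 0" using D(5)[OF q] by (meson injD)
    then have "?w $ 1 = 0" by simp
    then have "v q = 0" by (simp add: axis_def)
    then have "?A q (axis 2 1) = ?A q 0" using lin[OF q] by (simp add: v_def linear_0)
    then have "axis 2 1 = (0 :: real^2)" using D(5)[OF q] by (meson injD)
    then show False by (simp add: axis_eq_0_iff)
  qed
  have "tng (\<phi> q) y = a q *\<^sub>R u q + b q *\<^sub>R v q" if q: "q \<in> U" for q
  proof (rule tan_part_unique)
    have "a q *\<^sub>R u q + b q *\<^sub>R v q = ?A q (a q *\<^sub>R axis 1 1 + b q *\<^sub>R axis 2 1)"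
      using lin[OF q] by (simp add: linear_add linear_cmul u_def v_def)
    then show "a q *\<^sub>R u q + b q *\<^sub>R v q \<in> T (\<phi> q)"
      unfolding tangent_plane_eq_range[OF \<phi> q] by blast
    have ab: "a q * \<Delta> q = (v q \<bullet> v q) * (u q \<bullet> y) - (u q \<bullet> v q) * (v q \<bullet> y)"
      "b q * \<Delta> q = (u q \<bullet> u q) * (v q \<bullet> y) - (u q \<bullet> v q) * (u q \<bullet> y)"
      using nz[OF q] by (simp_all add: a_def b_def)
    have "(a q * (u q \<bullet> u q) + b q * (u q \<bullet> v q)) * \<Delta> q
        = (a q * \<Delta> q) * (u q \<bullet> u q) + (b q * \<Delta> q) * (u q \<bullet> v q)"
      by (simp add: algebra_simps)
    also have "\<dots> = (u q \<bullet> y) * \<Delta> q"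
      unfolding ab by (simp add: \<Delta>_def algebra_simps)
    finally have 1: "u q \<bullet> (y - (a q *\<^sub>R u q + b q *\<^sub>R v q)) = 0"
      using nz[OF q] by (simp add: inner_diff_right inner_add_right)
    have "(a q * (v q \<bullet> u q) + b q * (v q \<bullet> v q)) * \<Delta> q
        = (a q * \<Delta> q) * (u q \<bullet> v q) + (b q * \<Delta> q) * (v q \<bullet> v q)"
      by (simp add: algebra_simps inner_commute[of "v q" "u q"])
    also have "\<dots> = (v q \<bullet> y) * \<Delta> q"
      unfolding ab by (simp add: \<Delta>_def algebra_simps)
    finally have 2: "v q \<bullet> (y - (a q *\<^sub>R u q + b q *\<^sub>R v q)) = 0"
      using nz[OF q] by (simp add: inner_diff_right inner_add_right)
    show "y - (a q *\<^sub>R u q + b q *\<^sub>R v q) \<in> N (\<phi> q)"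
      unfolding normal_plane_iff tangent_plane_eq_range[OF \<phi> q]
      using 1 2 by (auto simp: comb[OF q] inner_add_left)
  qed
  moreover have su: "smooth_on U u" and sv: "smooth_on U v"
    unfolding u_def v_def using smooth_on_frechet_derivative[OF D(1,4)] by auto
  note ip = smooth_on_bilinear[OF bounded_bilinear_inner D(1)]
    and mu = smooth_on_bilinear[OF bounded_bilinear_mult D(1)]
    and df = smooth_on_diff[OF D(1)]
  have s\<Delta>: "smooth_on U \<Delta>"
    unfolding \<Delta>_def by (intro df mu ip su sv)
  have "smooth_on U a" "smooth_on U b"
    unfolding a_def b_def
    by (intro smooth_on_divide[OF D(1) _ s\<Delta> nz] df mu ip su sv smooth_on_const; assumption)+
  ultimately show ?thesis unfolding u_def v_def by blast
qed

lemma smooth_tan: "local_param \<iota> U \<phi> \<Longrightarrow> smooth_on U ((\<lambda>p. tng p y) \<circ> \<phi>)"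
proof -
  assume \<phi>: "local_param \<iota> U \<phi>"
  note D = local_paramD[OF \<phi>]
  obtain a b where ab: "\<And>q. q \<in> U \<Longrightarrow> tng (\<phi> q) y = a q *\<^sub>R frechet_derivative (\<iota> \<circ> \<phi>) (at q) (axis 1 1)
      + b q *\<^sub>R frechet_derivative (\<iota> \<circ> \<phi>) (at q) (axis 2 1)" "smooth_on U a" "smooth_on U b"
    using tan_chart[OF \<phi>, of y] by blast
  have "smooth_on U (\<lambda>q. a q *\<^sub>R frechet_derivative (\<iota> \<circ> \<phi>) (at q) (axis 1 1)
      + b q *\<^sub>R frechet_derivative (\<iota> \<circ> \<phi>) (at q) (axis 2 1))"
    by (rule smooth_on_add[OF D(1)]; rule smooth_on_bilinear[OF bounded_bilinear_scaleR D(1)])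
      (rule ab(2,3) smooth_on_frechet_derivative[OF D(1,4)])+
  then show ?thesis
    using smooth_on_cong[OF D(1), of "(\<lambda>p. tng p y) \<circ> \<phi>"] ab(1) by simp
qed

text \<open>
  The tangent part of a constant vector is a global tangent field, so every tangent vector has an
  extension.
\<close>

lemma tangent_field_tan: "tangent_field \<iota> UNIV (\<lambda>p. tng p y)"
  by (simp add: tangent_field_def tan_in smooth_tan)

lemma differentiable_chart:
  assumes "local_param \<iota> U \<phi>" "q \<in> U" "smooth_on U (Y \<circ> \<phi>)"
  shows "(Y \<circ> \<phi>) differentiable (at q)"
  using smooth_on_has_derivative[OF local_paramD(1)[OF assms(1)] assms(3,2)] differentiableI by blast

lemma surf_differentiable_tan: "surf_differentiable \<iota> (\<lambda>p. tng p y) p"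
proof -
  obtain U \<phi> q where \<phi>: "local_param \<iota> U \<phi>" "q \<in> U" "\<phi> q = p"
    using exists_chart by blast
  with differentiable_chart[OF \<phi>(1,2) smooth_tan[OF \<phi>(1)]] show ?thesis
    unfolding surf_differentiable_def by blast
qed

section \<open>The second fundamental form as derivative of the projection\<close>

lemma surf_differentiable_chart:
  assumes "surf_differentiable \<iota> Y (\<phi> q)" "local_param \<iota> U \<phi>" "q \<in> U"
  shows "((Y \<circ> \<phi>) has_derivative (\<lambda>v. Dir (\<phi> q) (frechet_derivative (\<iota> \<circ> \<phi>) (at q) v) Y)) (at q)"
  using has_derivative_along(1)[of \<iota> Y \<phi> q] local_paramD(6,7)[OF assms(2,3)] assms(1) by blast

lemma linear_Dir_tan:
  assumes "surf_differentiable \<iota> Y p"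
  shows "linear (\<lambda>x. Dir p (tng p x) Y)"
proof -
  obtain U \<phi> q where \<phi>: "local_param \<iota> U \<phi>" "q \<in> U" "\<phi> q = p"
    using exists_chart by blast
  let ?A = "frechet_derivative (\<iota> \<circ> \<phi>) (at q)"
  have D: "linear (\<lambda>v. Dir p (?A v) Y)"
    using surf_differentiable_chart[OF _ \<phi>(1,2)] assms \<phi>(3) has_derivative_linear by blast
  have A: "linear ?A" using local_paramD(6)[OF \<phi>(1,2)] has_derivative_linear by blast
  obtain L where L: "linear L" "L \<circ> ?A = id"
    using linear_injective_left_inverse[OF A local_paramD(5)[OF \<phi>(1,2)]] by blast
  have "?A (L (tng p x)) = tng p x" for x
  proof -
    obtain v where "tng p x = ?A v" using tan_in[of p x] tangent_plane_eq_range[OF \<phi>(1,2)] \<phi>(3) by auto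
    then show ?thesis using L(2) by (metis comp_apply id_apply)
  qed
  then have "(\<lambda>x. Dir p (tng p x) Y) = (\<lambda>v. Dir p (?A v) Y) \<circ> (L \<circ> tng p)"
    by (simp add: comp_def)
  then show ?thesis
    using linear_compose[OF linear_compose[OF linear_tan L(1)] D] by simp
qed

lemma linear_Dir_field:
  assumes "x \<in> T p"
  shows "linear (\<lambda>y. Dir p x (\<lambda>q. tng q y))"
proof -
  obtain U \<phi> q where \<phi>: "local_param \<iota> U \<phi>" "q \<in> U" "\<phi> q = p"
    using exists_chart by blast
  obtain v where v: "x = frechet_derivative (\<iota> \<circ> \<phi>) (at q) v"
    using assms tangent_plane_eq_range[OF \<phi>(1,2)] \<phi>(3) by auto
  define A where "A = frechet_derivative (\<iota> \<circ> \<phi>) (at q)"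
  have d: "((\<lambda>r. tng (\<phi> r) y) has_derivative (\<lambda>v. Dir p (A v) (\<lambda>q. tng q y))) (at q)" for y
    using surf_differentiable_chart[OF surf_differentiable_tan \<phi>(1,2), of y]
    unfolding A_def \<phi>(3) comp_def .
  show ?thesis
  proof (rule linearI)
    fix y z
    have "((\<lambda>r. tng (\<phi> r) (y + z)) has_derivative
        (\<lambda>v. Dir p (A v) (\<lambda>q. tng q y) + Dir p (A v) (\<lambda>q. tng q z))) (at q)"
      using has_derivative_add[OF d d] by (simp add: linear_add[OF linear_tan])
    from fun_cong[OF has_derivative_unique[OF d this], of v]
    show "Dir p x (\<lambda>q. tng q (y + z)) = Dir p x (\<lambda>q. tng q y) + Dir p x (\<lambda>q. tng q z)"
      unfolding v A_def .
  next
    fix r y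
    have "((\<lambda>p. tng (\<phi> p) (r *\<^sub>R y)) has_derivative (\<lambda>v. r *\<^sub>R Dir p (A v) (\<lambda>q. tng q y))) (at q)"
      using has_derivative_scaleR_right[OF d] by (simp add: linear_cmul[OF linear_tan])
    from fun_cong[OF has_derivative_unique[OF d this], of v]
    show "Dir p x (\<lambda>q. tng q (r *\<^sub>R y)) = r *\<^sub>R Dir p x (\<lambda>q. tng q y)"
      unfolding v A_def .
  qed
qed

lemma tangent_field_chart:
  assumes Y: "tangent_field \<iota> W Y" "p \<in> W"
  shows "\<exists>U \<phi> q. local_param \<iota> U \<phi> \<and> q \<in> U \<and> \<phi> q = p \<and> \<phi> ` U \<subseteq> W"
proof -
  obtain U \<phi> q where \<phi>: "local_param \<iota> U \<phi>" "q \<in> U" "\<phi> q = p"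
    using exists_chart by blast
  have "open W" using Y unfolding tangent_field_def by blast
  from local_param_restrict[OF \<phi>(1) this] \<phi> Y(2) show ?thesis
    by (intro exI[of _ "U \<inter> \<phi> -` W"] exI[of _ \<phi>] exI[of _ q]) auto
qed

lemma surf_differentiable_field:
  assumes Y: "tangent_field \<iota> W Y" "p \<in> W"
  shows "surf_differentiable \<iota> Y p"
proof -
  obtain U \<phi> q where \<phi>: "local_param \<iota> U \<phi>" "q \<in> U" "\<phi> q = p" "\<phi> ` U \<subseteq> W"
    using tangent_field_chart[OF Y] by blast
  then have "smooth_on U (Y \<circ> \<phi>)" using Y unfolding tangent_field_def by blast
  then show ?thesis
    using \<phi> differentiable_chart unfolding surf_differentiable_def by blast
qed

text \<open>
  Differentiating \<open>Y q = tng q (Y q)\<close> gives \<open>D\<^sub>xY = (D\<^sub>x tng)(Y p) + tng p (D\<^sub>xY)\<close>. Hence the normal part of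
  \<open>D\<^sub>xY\<close> depends on \<open>Y p\<close> only, and the second fundamental form is well defined.
\<close>

lemma nor_Dir_field:
  assumes Y: "tangent_field \<iota> W Y" "p \<in> W" and x: "x \<in> T p"
  shows "nor p (Dir p x Y) = Dir p x (\<lambda>q. tng q (Y p))"
proof -
  obtain U \<phi> q where \<phi>: "local_param \<iota> U \<phi>" "q \<in> U" "\<phi> q = p" "\<phi> ` U \<subseteq> W"
    using tangent_field_chart[OF Y] by blast
  obtain v where v: "x = frechet_derivative (\<iota> \<circ> \<phi>) (at q) v"
    using x tangent_plane_eq_range[OF \<phi>(1,2)] \<phi>(3) by auto
  define A where "A = frechet_derivative (\<iota> \<circ> \<phi>) (at q)"
  have dY: "((\<lambda>r. Y (\<phi> r)) has_derivative (\<lambda>v. Dir p (A v) Y)) (at q)"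
    using surf_differentiable_chart[of Y, OF _ \<phi>(1,2)] surf_differentiable_field[OF Y]
    unfolding A_def \<phi>(3) comp_def by blast
  have dT: "((\<lambda>r. tng (\<phi> r) y) has_derivative (\<lambda>v. Dir p (A v) (\<lambda>q. tng q y))) (at q)" for y
    using surf_differentiable_chart[OF surf_differentiable_tan \<phi>(1,2), of y]
    unfolding A_def \<phi>(3) comp_def .
  have "((\<lambda>r. Y (\<phi> r)) has_derivative
      (\<lambda>v. Dir p (A v) (\<lambda>r. tng r (Y (\<phi> q))) + tng (\<phi> q) (Dir p (A v) Y))) (at q)"
  proof (rule has_derivative_transform_within_open[OF _ local_paramD(1)[OF \<phi>(1)] \<phi>(2)])
    show "((\<lambda>r. tng (\<phi> r) (Y (\<phi> r))) has_derivative
      (\<lambda>v. Dir p (A v) (\<lambda>r. tng r (Y (\<phi> q))) + tng (\<phi> q) (Dir p (A v) Y))) (at q)"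
      by (rule has_derivative_linear_family[OF open_UNIV UNIV_I linear_tan dT dY])
    show "tng (\<phi> r) (Y (\<phi> r)) = Y (\<phi> r)" if "r \<in> U" for r
      using Y \<phi>(4) that unfolding tangent_field_def by (auto intro!: tan_id)
  qed
  from fun_cong[OF has_derivative_unique[OF dY this], of v]
  have "Dir p x Y = Dir p x (\<lambda>r. tng r (Y p)) + tng p (Dir p x Y)"
    unfolding v A_def \<phi>(3) .
  then show ?thesis unfolding nor_part_def by (rule diff_eq_eq[THEN iffD2])
qed

lemma sff_eq:
  assumes "x \<in> T p" "y \<in> T p"
  shows "sff \<iota> p x y = Dir p x (\<lambda>q. tng q y)"
  unfolding sff_def
proof (rule the_equality)
  have "nor p (Dir p x (\<lambda>q. tng q y)) = Dir p x (\<lambda>q. tng q y)"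
    using nor_Dir_field[OF tangent_field_tan UNIV_I assms(1), of y] assms(2) by (simp add: tan_id)
  then show "\<exists>W Y. tangent_field \<iota> W Y \<and> p \<in> W \<and> Y p = y \<and> Dir p x (\<lambda>q. tng q y) = nor p (Dir p x Y)"
    using tangent_field_tan[of y] tan_id[OF assms(2)] by (metis UNIV_I)
next
  fix b assume "\<exists>W Y. tangent_field \<iota> W Y \<and> p \<in> W \<and> Y p = y \<and> b = nor p (Dir p x Y)"
  then show "b = Dir p x (\<lambda>q. tng q y)" using nor_Dir_field assms(1) by blast
qed

lemma nor_Dir_tan: "x \<in> T p \<Longrightarrow> nor p (Dir p x (\<lambda>q. tng q w)) = sff \<iota> p x (tng p w)"
  using nor_Dir_field[OF tangent_field_tan UNIV_I] by (simp add: sff_eq tan_in)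

lemma sff_normal: "x \<in> T p \<Longrightarrow> y \<in> T p \<Longrightarrow> sff \<iota> p x y \<in> N p"
  by (metis nor_Dir_tan nor_in tan_id)

text \<open>
  The second fundamental form, extended to bilinear maps on the ambient space, so that its values along
  the surface can be differentiated with constant arguments.
\<close>

definition II :: "'a \<Rightarrow> real^4 \<Rightarrow> real^4 \<Rightarrow> real^4" where
  "II p y z = sff \<iota> p (tng p y) (tng p z)"

lemma II_eq_Dir: "II p y z = Dir p (tng p y) (\<lambda>q. tng q (tng p z))"
  unfolding II_def by (rule sff_eq[OF tan_in tan_in])

lemma II_eq_sff: "y \<in> T p \<Longrightarrow> z \<in> T p \<Longrightarrow> II p y z = sff \<iota> p y z"
  by (simp add: II_def tan_id)

lemma II_normal: "II p y z \<in> N p"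
  unfolding II_def by (rule sff_normal[OF tan_in tan_in])

lemma linear_II_left: "linear (\<lambda>y. II p y z)"
  unfolding II_eq_Dir by (rule linear_Dir_tan[OF surf_differentiable_tan])

lemma linear_II_right: "linear (II p y)"
  using linear_compose[OF linear_tan linear_Dir_field[OF tan_in]]
  unfolding II_eq_Dir[abs_def] comp_def .

text \<open>
  With \<open>tng y = a u + b v\<close> in the basis given by a chart, \<open>II y z\<close> is a combination, with differentiable
  coefficients \<open>a, b\<close>, of the partial derivatives of the smooth projection, applied to \<open>tng z\<close>.
\<close>

lemma surf_differentiable_II: "surf_differentiable \<iota> (\<lambda>p. II p y z) p"
proof -
  obtain U \<phi> q where \<phi>: "local_param \<iota> U \<phi>" "q \<in> U" "\<phi> q = p"
    using exists_chart by blast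
  note D = local_paramD[OF \<phi>(1)]
  let ?A = "\<lambda>q. frechet_derivative (\<iota> \<circ> \<phi>) (at q)"
  let ?B = "\<lambda>i r w. Dir (\<phi> r) (?A r (axis i 1)) (\<lambda>q. tng q w)"
  obtain a b where ab: "\<And>q. q \<in> U \<Longrightarrow> tng (\<phi> q) y = a q *\<^sub>R ?A q (axis 1 1)
      + b q *\<^sub>R ?A q (axis 2 1)" "smooth_on U a" "smooth_on U b"
    using tan_chart[OF \<phi>(1), of y] by blast
  have A: "linear (?A r)" if "r \<in> U" for r
    using D(6)[OF that] has_derivative_linear by blast
  have AT: "?A r v \<in> T (\<phi> r)" if "r \<in> U" for r v
    using tangent_plane_eq_range[OF \<phi>(1) that] by blast
  have B: "(\<lambda>r. ?B i r w) differentiable (at q)" for i w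
  proof -
    have "frechet_derivative ((\<lambda>p. tng p w) \<circ> \<phi>) (at r) (axis i 1) = ?B i r w" if "r \<in> U" for r
      by (simp add: frechet_derivative_at[OF surf_differentiable_chart[OF surf_differentiable_tan[of w] \<phi>(1) that],
          symmetric])
    then have "smooth_on U (\<lambda>r. ?B i r w)"
      by (rule smooth_on_cong[OF D(1), THEN iffD1])
        (assumption | rule smooth_on_frechet_derivative[OF D(1) smooth_tan[OF \<phi>(1), of w]])+
    then show ?thesis using smooth_on_has_derivative[OF D(1) _ \<phi>(2)] differentiableI by blast
  qed
  have Bt: "(\<lambda>r. ?B i r (tng (\<phi> r) z)) differentiable (at q)" for i
  proof -
    have "((\<lambda>r. ?B i r w) has_derivative frechet_derivative (\<lambda>r. ?B i r w) (at q)) (at q)" for w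
      using B frechet_derivative_works by blast
    note has_derivative_linear_family[OF D(1) \<phi>(2) linear_Dir_field[OF AT] this
        surf_differentiable_chart[OF surf_differentiable_tan[of z] \<phi>(1,2), unfolded comp_def[of "\<lambda>p. tng p z"]]]
    then show ?thesis using differentiableI by blast
  qed
  have da: "a differentiable (at q)" and db: "b differentiable (at q)"
    using smooth_on_has_derivative[OF D(1) _ \<phi>(2)] ab(2,3) differentiableI by blast+
  have "(\<lambda>r. a r *\<^sub>R ?B 1 r (tng (\<phi> r) z) + b r *\<^sub>R ?B 2 r (tng (\<phi> r) z)) differentiable (at q)"
    by (intro differentiable_add differentiable_scaleR da db Bt)
  then obtain F where F: "((\<lambda>r. a r *\<^sub>R ?B 1 r (tng (\<phi> r) z) + b r *\<^sub>R ?B 2 r (tng (\<phi> r) z)) has_derivative F) (at q)"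
    unfolding differentiable_def by blast
  have "a r *\<^sub>R ?B 1 r (tng (\<phi> r) z) + b r *\<^sub>R ?B 2 r (tng (\<phi> r) z) = ((\<lambda>p. II p y z) \<circ> \<phi>) r"
    if r: "r \<in> U" for r
  proof -
    note lin = linear_Dir_tan[OF surf_differentiable_tan[of "tng (\<phi> r) z" "\<phi> r"]]
    have "((\<lambda>p. II p y z) \<circ> \<phi>) r = Dir (\<phi> r) (tng (\<phi> r) (tng (\<phi> r) y)) (\<lambda>q. tng q (tng (\<phi> r) z))"
      by (simp add: II_eq_Dir)
    also have "\<dots> = a r *\<^sub>R Dir (\<phi> r) (tng (\<phi> r) (?A r (axis 1 1))) (\<lambda>q. tng q (tng (\<phi> r) z))
        + b r *\<^sub>R Dir (\<phi> r) (tng (\<phi> r) (?A r (axis 2 1))) (\<lambda>q. tng q (tng (\<phi> r) z))"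
      by (subst ab(1)[OF r]) (simp only: linear_add[OF lin] linear_cmul[OF lin])
    finally show ?thesis by (simp add: tan_id[OF AT[OF r]])
  qed
  then have "(((\<lambda>p. II p y z) \<circ> \<phi>) has_derivative F) (at q)"
    by (rule has_derivative_transform_within_open[OF F D(1) \<phi>(2)])
  then show ?thesis unfolding surf_differentiable_def using \<phi> differentiableI by blast
qed

section \<open>The covariant derivative of the second fundamental form\<close>

lemma Dir_chart:
  assumes "local_param \<iota> U \<phi>" "q \<in> U" "((Y \<circ> \<phi>) has_derivative F) (at q)"
  shows "Dir (\<phi> q) (frechet_derivative (\<iota> \<circ> \<phi>) (at q) v) Y = F v"
  using dir_deriv_chart[OF assms(1,2) differentiableI[OF assms(3)]] frechet_derivative_at[OF assms(3)]
  by metis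

lemma Dir_scaleR:
  assumes "surf_differentiable \<iota> Y p" "x \<in> T p"
  shows "Dir p (r *\<^sub>R x) (\<lambda>q. s *\<^sub>R Y q) = (r * s) *\<^sub>R Dir p x Y"
proof -
  obtain U \<phi> q where \<phi>: "local_param \<iota> U \<phi>" "q \<in> U" "\<phi> q = p"
    using exists_chart by blast
  have rx: "r *\<^sub>R x \<in> T p" by (rule subspace_scale[OF subspace_T assms(2)])
  then obtain w where w: "r *\<^sub>R x = frechet_derivative (\<iota> \<circ> \<phi>) (at q) w"
    using tangent_plane_eq_range[OF \<phi>(1,2)] \<phi>(3) by blast
  have Y: "((Y \<circ> \<phi>) has_derivative (\<lambda>v. Dir p (frechet_derivative (\<iota> \<circ> \<phi>) (at q) v) Y)) (at q)"
    using surf_differentiable_chart[OF _ \<phi>(1,2)] assms(1) \<phi>(3) by blast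
  have sY: "(((\<lambda>q. s *\<^sub>R Y q) \<circ> \<phi>) has_derivative
      (\<lambda>v. s *\<^sub>R Dir p (frechet_derivative (\<iota> \<circ> \<phi>) (at q) v) Y)) (at q)"
    using has_derivative_scaleR_right[OF Y, of s] unfolding comp_def .
  have "Dir p (r *\<^sub>R x) (\<lambda>q. s *\<^sub>R Y q) = s *\<^sub>R Dir p (r *\<^sub>R x) Y"
    using Dir_chart[OF \<phi>(1,2) sY, of w] unfolding w \<phi>(3) .
  also have "Dir p (r *\<^sub>R x) Y = r *\<^sub>R Dir p x Y"
    using linear_cmul[OF linear_Dir_tan[OF assms(1)], of r x] by (simp add: tan_id[OF rx] tan_id[OF assms(2)])
  finally show ?thesis by (simp add: mult.commute)
qed

lemma Dir_sff_fields:
  assumes Y: "tangent_field \<iota> W Y" and Z: "tangent_field \<iota> W Z" and p: "p \<in> W" and x: "x \<in> T p"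
  shows "Dir p x (\<lambda>q. sff \<iota> q (Y q) (Z q)) =
    Dir p x (\<lambda>q. II q (Y p) (Z p)) + II p (Y p) (Dir p x Z) + II p (Dir p x Y) (Z p)"
proof -
  obtain U \<phi> q where \<phi>: "local_param \<iota> U \<phi>" "q \<in> U" "\<phi> q = p" "\<phi> ` U \<subseteq> W"
    using tangent_field_chart[OF Y p] by blast
  obtain v where v: "x = frechet_derivative (\<iota> \<circ> \<phi>) (at q) v"
    using x tangent_plane_eq_range[OF \<phi>(1,2)] \<phi>(3) by auto
  define A where "A = frechet_derivative (\<iota> \<circ> \<phi>) (at q)"
  have d: "((\<lambda>r. X (\<phi> r)) has_derivative (\<lambda>v. Dir p (A v) X)) (at q)" if "surf_differentiable \<iota> X p" for X
    using surf_differentiable_chart[of X, OF _ \<phi>(1,2)] that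
    unfolding A_def \<phi>(3) comp_def by blast
  note dY = d[OF surf_differentiable_field[OF Y p]] and dZ = d[OF surf_differentiable_field[OF Z p]]
  have "((\<lambda>r. II (\<phi> r) (Y (\<phi> r)) (Z (\<phi> r))) has_derivative
      (\<lambda>v. (Dir p (A v) (\<lambda>r. II r (Y (\<phi> q)) (Z (\<phi> q))) + II (\<phi> q) (Y (\<phi> q)) (Dir p (A v) Z))
        + II (\<phi> q) (Dir p (A v) Y) (Z (\<phi> q)))) (at q)"
    by (rule has_derivative_linear_family[OF open_UNIV UNIV_I linear_II_left
          has_derivative_linear_family[OF open_UNIV UNIV_I linear_II_right d[OF surf_differentiable_II] dZ] dY])
  then have "(((\<lambda>q. sff \<iota> q (Y q) (Z q)) \<circ> \<phi>) has_derivative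
      (\<lambda>v. (Dir p (A v) (\<lambda>r. II r (Y (\<phi> q)) (Z (\<phi> q))) + II (\<phi> q) (Y (\<phi> q)) (Dir p (A v) Z))
        + II (\<phi> q) (Dir p (A v) Y) (Z (\<phi> q)))) (at q)"
  proof (rule has_derivative_transform_within_open[OF _ local_paramD(1)[OF \<phi>(1)] \<phi>(2)])
    show "II (\<phi> r) (Y (\<phi> r)) (Z (\<phi> r)) = ((\<lambda>q. sff \<iota> q (Y q) (Z q)) \<circ> \<phi>) r" if "r \<in> U" for r
      using Y Z \<phi>(4) that unfolding tangent_field_def by (auto intro!: II_eq_sff)
  qed
  from Dir_chart[OF \<phi>(1,2) this, of v] show ?thesis
    unfolding v A_def \<phi>(3) .
qed

text \<open>
  The correction terms in the definition of the covariant derivative cancel the part of the product rule in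
  which the fields \<open>Y, Z\<close> are differentiated; so the covariant derivative is a tensor.
\<close>

lemma cov_sff_fields:
  assumes Y: "tangent_field \<iota> W Y" and Z: "tangent_field \<iota> W Z" and p: "p \<in> W" and x: "x \<in> T p"
  shows "nor p (Dir p x (\<lambda>q. sff \<iota> q (Y q) (Z q)))
      - sff \<iota> p (tng p (Dir p x Y)) (Z p) - sff \<iota> p (Y p) (tng p (Dir p x Z))
    = nor p (Dir p x (\<lambda>q. II q (Y p) (Z p)))"
proof -
  have "Y p \<in> T p" "Z p \<in> T p" using Y Z p unfolding tangent_field_def by blast+
  then have "sff \<iota> p (tng p (Dir p x Y)) (Z p) = II p (Dir p x Y) (Z p)"
    "sff \<iota> p (Y p) (tng p (Dir p x Z)) = II p (Y p) (Dir p x Z)"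
    by (simp_all add: II_def tan_id)
  then show ?thesis
    by (simp add: Dir_sff_fields[OF assms] linear_add[OF linear_nor] nor_id[OF II_normal])
qed

lemma cov_sff_eq:
  assumes "x \<in> T p" "y \<in> T p" "z \<in> T p"
  shows "cov_sff \<iota> p x y z = nor p (Dir p x (\<lambda>q. II q y z))"
  unfolding cov_sff_def
proof (rule the_equality)
  note c = cov_sff_fields[OF tangent_field_tan[of y] tangent_field_tan[of z] UNIV_I assms(1)]
  show "\<exists>W Y Z. tangent_field \<iota> W Y \<and> tangent_field \<iota> W Z \<and> p \<in> W \<and> Y p = y \<and> Z p = z \<and>
      nor p (Dir p x (\<lambda>q. II q y z)) = nor p (Dir p x (\<lambda>q. sff \<iota> q (Y q) (Z q)))
        - sff \<iota> p (tng p (Dir p x Y)) z - sff \<iota> p y (tng p (Dir p x Z))"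
    by (rule exI[of _ UNIV], rule exI[of _ "\<lambda>p. tng p y"], rule exI[of _ "\<lambda>p. tng p z"])
      (use c assms(2,3) in \<open>simp add: tan_id tangent_field_tan\<close>)
next
  fix w
  assume "\<exists>W Y Z. tangent_field \<iota> W Y \<and> tangent_field \<iota> W Z \<and> p \<in> W \<and> Y p = y \<and> Z p = z \<and>
      w = nor p (Dir p x (\<lambda>q. sff \<iota> q (Y q) (Z q)))
        - sff \<iota> p (tng p (Dir p x Y)) z - sff \<iota> p y (tng p (Dir p x Z))"
  then show "w = nor p (Dir p x (\<lambda>q. II q y z))"
    using cov_sff_fields[OF _ _ _ assms(1)] by blast
qed

lemma cov_sff_normal: "x \<in> T p \<Longrightarrow> y \<in> T p \<Longrightarrow> z \<in> T p \<Longrightarrow> cov_sff \<iota> p x y z \<in> N p"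
  by (simp add: cov_sff_eq nor_in)

lemma cov_sff_scaleR:
  assumes x: "x \<in> T p"
  shows "cov_sff \<iota> p (r *\<^sub>R x) (r *\<^sub>R x) (r *\<^sub>R x) = r ^ 3 *\<^sub>R cov_sff \<iota> p x x x"
proof -
  have rx: "r *\<^sub>R x \<in> T p" using subspace_scale[OF subspace_T x] .
  have "(\<lambda>q. II q (r *\<^sub>R x) (r *\<^sub>R x)) = (\<lambda>q. (r * r) *\<^sub>R II q x x)"
    by (simp add: linear_cmul[OF linear_II_left] linear_cmul[OF linear_II_right])
  then show ?thesis
    by (simp add: cov_sff_eq[OF x x x] cov_sff_eq[OF rx rx rx] Dir_scaleR[OF surf_differentiable_II x]
        linear_cmul[OF linear_nor] power3_eq_cube mult.assoc)
qed

section \<open>Curves on the surface up to third order\<close>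

lemma has_vector_derivative_along:
  assumes Y: "surf_differentiable \<iota> Y (c t)"
    and c: "isCont c t" "((\<iota> \<circ> c) has_vector_derivative s) (at t)"
  shows "((\<lambda>r. Y (c r)) has_vector_derivative Dir (c t) s Y) (at t)" and "s \<in> T (c t)"
proof -
  note c2 = c(2)[unfolded has_vector_derivative_def]
  show s: "s \<in> T (c t)" using has_derivative_along(2)[OF Y c(1) c2, of 1] by simp
  note D = has_derivative_along(1)[OF Y c(1) c2]
  have "(\<lambda>v. Dir (c t) (v *\<^sub>R s) Y) = (\<lambda>v. v *\<^sub>R Dir (c t) s Y)"
    using Dir_scaleR[OF Y s, of _ 1] by simp
  with D show "((\<lambda>r. Y (c r)) has_vector_derivative Dir (c t) s Y) (at t)"
    unfolding has_vector_derivative_def by (simp add: comp_def)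
qed

lemma smooth_curveD:
  assumes "smooth_curve \<iota> I c" "t \<in> I"
  shows "isCont c t"
    and "((\<iota> \<circ> c) has_vector_derivative vel (\<iota> \<circ> c) t) (at t)"
    and "(vel (\<iota> \<circ> c) has_vector_derivative vel (vel (\<iota> \<circ> c)) t) (at t)"
    and "(vel (vel (\<iota> \<circ> c)) has_vector_derivative vel (vel (vel (\<iota> \<circ> c))) t) (at t)"
    and "vel (\<iota> \<circ> c) t \<in> T (c t)"
proof -
  have I: "open I" "continuous_on I c" "smooth_on I (\<iota> \<circ> c)"
    using assms(1) unfolding smooth_curve_def by auto
  show c: "isCont c t" using I(1,2) assms(2) by (simp add: continuous_on_eq_continuous_at)
  note v = smooth_on_vel[OF I(1)]
  show 1: "((\<iota> \<circ> c) has_vector_derivative vel (\<iota> \<circ> c) t) (at t)"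
    by (rule v(1)[OF I(3) assms(2)])
  show "(vel (\<iota> \<circ> c) has_vector_derivative vel (vel (\<iota> \<circ> c)) t) (at t)"
    by (rule v(1)[OF v(2)[OF I(3)] assms(2)])
  show "(vel (vel (\<iota> \<circ> c)) has_vector_derivative vel (vel (vel (\<iota> \<circ> c))) t) (at t)"
    by (rule v(1)[OF v(2)[OF v(2)[OF I(3)]] assms(2)])
  show "vel (\<iota> \<circ> c) t \<in> T (c t)"
    by (rule has_vector_derivative_along(2)[OF surf_differentiable_tan c 1])
qed

lemma nor_acceleration:
  assumes c: "smooth_curve \<iota> I c" "t \<in> I"
  shows "nor (c t) (vel (vel (\<iota> \<circ> c)) t) = II (c t) (vel (\<iota> \<circ> c) t) (vel (\<iota> \<circ> c) t)"
proof -
  let ?v = "vel (\<iota> \<circ> c)"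
  note D = smooth_curveD[OF c]
  have I: "open I" using c(1) unfolding smooth_curve_def by auto
  have "((\<lambda>r. tng (c r) (?v r)) has_vector_derivative
      Dir (c t) (?v t) (\<lambda>q. tng q (?v t)) + tng (c t) (vel ?v t)) (at t)"
    by (rule has_vector_derivative_linear_family[OF linear_tan
          has_vector_derivative_along(1)[OF surf_differentiable_tan D(1,2)] D(3)])
  then have "(?v has_vector_derivative
      Dir (c t) (?v t) (\<lambda>q. tng q (?v t)) + tng (c t) (vel ?v t)) (at t)"
    by (rule has_vector_derivative_transform_within_open[OF _ I c(2)])
      (simp add: tan_id smooth_curveD(5)[OF c(1)])
  from vector_derivative_unique_at[OF D(3) this]
  have "vel ?v t - tng (c t) (vel ?v t) = Dir (c t) (?v t) (\<lambda>q. tng q (?v t))"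
    by (rule diff_eq_eq[THEN iffD2])
  then show ?thesis
    unfolding nor_part_def II_eq_Dir by (simp add: tan_id[OF D(5)])
qed

lemma has_vector_derivative_II:
  assumes c: "smooth_curve \<iota> I c" "t \<in> I"
  defines "v \<equiv> vel (\<iota> \<circ> c)"
  shows "\<exists>a'. ((\<lambda>r. II (c r) (v r) (v r)) has_vector_derivative a') (at t) \<and>
    nor (c t) a' = cov_sff \<iota> (c t) (v t) (v t) (v t) + II (c t) (v t) (vel v t) + II (c t) (vel v t) (v t)"
proof -
  let ?v = "vel (\<iota> \<circ> c)"
  note D = smooth_curveD[OF c]
  have "((\<lambda>r. II (c r) (?v r) (?v r)) has_vector_derivative
      (Dir (c t) (?v t) (\<lambda>q. II q (?v t) (?v t)) + II (c t) (?v t) (vel ?v t)) + II (c t) (vel ?v t) (?v t)) (at t)"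
    by (rule has_vector_derivative_linear_family[OF linear_II_left
          has_vector_derivative_linear_family[OF linear_II_right
            has_vector_derivative_along(1)[OF surf_differentiable_II smooth_curveD(1,2)[OF c]] D(3)] D(3)])
  then show ?thesis
    unfolding v_def by (intro exI conjI)
      (assumption, simp add: linear_add[OF linear_nor] nor_id[OF II_normal] cov_sff_eq[OF D(5,5,5)])
qed

text \<open>
  The acceleration is \<open>II v v + tng v'\<close>. To the normal part of its derivative, the first summand
  contributes the covariant derivative and one term for each argument of \<open>II\<close>; the derivative of the
  projection in the second summand contributes another \<open>II v v'\<close>.
\<close>

lemma nor_jerk:
  assumes c: "smooth_curve \<iota> I c" "t \<in> I"
  defines "v \<equiv> vel (\<iota> \<circ> c)"
  shows "nor (c t) (vel (vel v) t) =
    cov_sff \<iota> (c t) (v t) (v t) (v t) + 2 *\<^sub>R II (c t) (v t) (vel v t) + II (c t) (vel v t) (v t)"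
proof -
  let ?v = "vel (\<iota> \<circ> c)"
  note D = smooth_curveD[OF c]
  have I: "open I" using c(1) unfolding smooth_curve_def by auto
  obtain a' where a': "((\<lambda>r. II (c r) (?v r) (?v r)) has_vector_derivative a') (at t)"
    "nor (c t) a' = cov_sff \<iota> (c t) (?v t) (?v t) (?v t) + II (c t) (?v t) (vel ?v t) + II (c t) (vel ?v t) (?v t)"
    using has_vector_derivative_II[OF c] by blast
  have "((\<lambda>r. tng (c r) (vel ?v r)) has_vector_derivative
      Dir (c t) (?v t) (\<lambda>q. tng q (vel ?v t)) + tng (c t) (vel (vel ?v) t)) (at t)"
    by (rule has_vector_derivative_linear_family[OF linear_tan
          has_vector_derivative_along(1)[OF surf_differentiable_tan smooth_curveD(1,2)[OF c]] D(4)])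
  from has_vector_derivative_add[OF a'(1) this]
  have "(vel ?v has_vector_derivative
      a' + (Dir (c t) (?v t) (\<lambda>q. tng q (vel ?v t)) + tng (c t) (vel (vel ?v) t))) (at t)"
    by (rule has_vector_derivative_transform_within_open[OF _ I c(2)])
      (simp add: nor_acceleration[OF c(1), symmetric] nor_part_def)
  from vector_derivative_unique_at[OF D(4) this]
  have "nor (c t) (vel (vel ?v) t) =
      nor (c t) (a' + (Dir (c t) (?v t) (\<lambda>q. tng q (vel ?v t)) + tng (c t) (vel (vel ?v) t)))"
    by (rule arg_cong)
  also have "\<dots> = nor (c t) a' + II (c t) (?v t) (vel ?v t)"
    by (simp add: linear_add[OF linear_nor] nor_tangent[OF tan_in] nor_Dir_tan[OF D(5)] II_def tan_id[OF D(5)])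
  finally show ?thesis unfolding v_def a'(2) by (simp add: scaleR_2)
qed

section \<open>Rib directions, geodesic curvature and normal torsion\<close>

lemma dim_normal_plane: "dim (N p) = 2"
proof -
  have "dim (T p) + dim (N p) = DIM(real^4)"
    unfolding normal_plane_def
    using dim_subspace_orthogonal_to_vectors[OF subspace_T[of p] subspace_UNIV]
    by (simp add: orthogonal_comp_def)
  then show ?thesis using tangent_plane_subspace(2)[OF imm, of p] by simp
qed

text \<open>
  The second condition is linear in its test vector, and \<open>x, J x\<close> is an orthonormal basis of the tangent
  plane. For normal \<open>u\<close> the cubic \<open>d3\<close> has at the unit vector \<open>x\<close> the value
  \<open>1 - u \<bullet> \<alpha>(x,x) - (u \<bullet> (\<nabla>\<^sub>x\<alpha>)(x,x))/3\<close>.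
\<close>

lemma rib_direction_iff:
  assumes x: "x \<in> T m" "norm x = 1" and J: "quarter_turn_on (T m) J"
  shows "determines_rib_direction \<iota> m u x \<longleftrightarrow>
    u \<in> N m \<and> u \<bullet> sff \<iota> m x x = 1 \<and> u \<bullet> sff \<iota> m x (J x) = 0 \<and> u \<bullet> cov_sff \<iota> m x x x = 0"
proof -
  have xx: "x \<bullet> x = 1" using x(2) by (simp add: dot_square_norm)
  have Jx: "J x \<in> T m" "norm (J x) = 1" "x \<bullet> J x = 0"
    using J x unfolding quarter_turn_on_def by auto
  have nz: "x \<noteq> 0" "J x \<noteq> 0" using x(2) Jx(2) by auto
  have second: "(\<forall>y\<in>T m. x \<bullet> y - u \<bullet> sff \<iota> m x y = 0) \<longleftrightarrow>
      u \<bullet> sff \<iota> m x x = 1 \<and> u \<bullet> sff \<iota> m x (J x) = 0"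
  proof
    assume "\<forall>y\<in>T m. x \<bullet> y - u \<bullet> sff \<iota> m x y = 0"
    from bspec[OF this x(1)] bspec[OF this Jx(1)]
    show "u \<bullet> sff \<iota> m x x = 1 \<and> u \<bullet> sff \<iota> m x (J x) = 0" by (simp add: xx Jx(3))
  next
    assume u: "u \<bullet> sff \<iota> m x x = 1 \<and> u \<bullet> sff \<iota> m x (J x) = 0"
    show "\<forall>y\<in>T m. x \<bullet> y - u \<bullet> sff \<iota> m x y = 0"
    proof
      fix y assume y: "y \<in> T m"
      obtain s t where st: "y = s *\<^sub>R x + t *\<^sub>R J x"
        using plane_expansion[OF tangent_plane_subspace(2)[OF imm] x(1) Jx(1) nz Jx(3) y, symmetric] by blast
      have "sff \<iota> m x y = II m x y" using x(1) y by (simp add: II_eq_sff)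
      also have "\<dots> = s *\<^sub>R II m x x + t *\<^sub>R II m x (J x)"
        unfolding st by (simp add: linear_add[OF linear_II_right] linear_cmul[OF linear_II_right])
      finally have "sff \<iota> m x y = s *\<^sub>R sff \<iota> m x x + t *\<^sub>R sff \<iota> m x (J x)"
        using x(1) Jx(1) by (simp add: II_eq_sff)
      then show "x \<bullet> y - u \<bullet> sff \<iota> m x y = 0"
        using u unfolding st by (simp add: inner_add_right xx Jx(3))
    qed
  qed
  have third: "d3 \<iota> m u x = 1 - u \<bullet> sff \<iota> m x x - (1/3) * (u \<bullet> cov_sff \<iota> m x x x)" if u: "u \<in> N m"
  proof -
    have "sff \<iota> m (tng m u) x = II m 0 x"
      using x(1) by (simp add: tan_normal[OF u] II_eq_sff subspace_0[OF subspace_T])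
    then have "sff \<iota> m (tng m u) x = 0" by (simp add: linear_0[OF linear_II_left])
    moreover have "u \<bullet> x = 0" using T_N_orthogonal[OF x(1) u] by (simp add: inner_commute)
    ultimately show ?thesis by (simp add: d3_def xx nor_id[OF u])
  qed
  show ?thesis
  proof (cases "u \<in> N m")
    case True
    have "u \<noteq> 0 \<and> (d3 \<iota> m u x = 0 \<longleftrightarrow> u \<bullet> cov_sff \<iota> m x x x = 0)" if "u \<bullet> sff \<iota> m x x = 1"
      using that by (auto simp: third[OF True])
    then show ?thesis
      unfolding determines_rib_direction_def second using x(1) nz(1) True by blast
  qed (simp add: determines_rib_direction_def)
qed

text \<open>
  The acceleration of a geodesic is normal, so the terms of the derivative of \<open>\<alpha>(\<gamma>',\<gamma>')\<close> that contain
  \<open>\<gamma>''\<close> vanish and its normal part is \<open>(\<nabla>\<^sub>x\<alpha>)(x,x)\<close>.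
\<close>

lemma geodesic_curvature_deriv:
  assumes \<gamma>: "geodesic \<iota> I \<gamma>" "t \<in> I"
  defines "x \<equiv> vel (\<iota> \<circ> \<gamma>) t"
  assumes b: "sff \<iota> (\<gamma> t) x x \<noteq> 0"
  shows "deriv (geodesic_curvature_fun \<iota> \<gamma>) t
    = (sff \<iota> (\<gamma> t) x x \<bullet> cov_sff \<iota> (\<gamma> t) x x x) / geodesic_curvature_fun \<iota> \<gamma> t"
proof (rule DERIV_imp_deriv)
  let ?v = "vel (\<iota> \<circ> \<gamma>)"
  have c: "smooth_curve \<iota> I \<gamma>" using \<gamma>(1) unfolding geodesic_def by blast
  then have I: "open I" unfolding smooth_curve_def by blast
  have vT: "?v s \<in> T (\<gamma> s)" if "s \<in> I" for s using smooth_curveD(5)[OF c that] .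
  define a where "a r = II (\<gamma> r) (?v r) (?v r)" for r
  have a: "a s = sff \<iota> (\<gamma> s) (?v s) (?v s)" if "s \<in> I" for s
    using II_eq_sff[OF vT[OF that] vT[OF that]] by (simp add: a_def)
  obtain a' where a': "(a has_vector_derivative a') (at t)"
    "nor (\<gamma> t) a' = cov_sff \<iota> (\<gamma> t) (?v t) (?v t) (?v t) + II (\<gamma> t) (?v t) (vel ?v t) + II (\<gamma> t) (vel ?v t) (?v t)"
    using has_vector_derivative_II[OF c \<gamma>(2)] unfolding a_def[abs_def] by blast
  have "tng (\<gamma> t) (vel ?v t) = 0" using \<gamma> unfolding geodesic_def by blast
  then have "II (\<gamma> t) y (vel ?v t) = II (\<gamma> t) y 0" "II (\<gamma> t) (vel ?v t) y = II (\<gamma> t) 0 y" for y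
    by (simp_all add: II_def linear_0[OF linear_tan])
  then have n: "nor (\<gamma> t) a' = cov_sff \<iota> (\<gamma> t) x x x"
    using a'(2) by (simp add: linear_0[OF linear_II_left] linear_0[OF linear_II_right] x_def)
  have at: "a t = sff \<iota> (\<gamma> t) x x" using a[OF \<gamma>(2)] by (simp add: x_def)
  have "a t \<in> N (\<gamma> t)" unfolding a_def by (rule II_normal)
  then have "a t \<bullet> a' = a t \<bullet> nor (\<gamma> t) a'"
    using inner_nor_part[of "a t" "\<gamma> t" a'] by (simp add: inner_commute)
  then have in': "a t \<bullet> a' = sff \<iota> (\<gamma> t) x x \<bullet> cov_sff \<iota> (\<gamma> t) x x x" by (simp add: n at)
  have "((\<lambda>r. a r \<bullet> a r) has_vector_derivative (a t \<bullet> a' + a' \<bullet> a t)) (at t)"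
    by (rule bounded_bilinear.has_vector_derivative[OF bounded_bilinear_inner a'(1) a'(1)])
  then have d: "((\<lambda>r. a r \<bullet> a r) has_real_derivative 2 * (a t \<bullet> a')) (at t)"
    unfolding has_real_derivative_iff_has_vector_derivative
    by (simp add: inner_commute[of a' "a t"])
  have pos: "a t \<bullet> a t > 0" using b at by simp
  have sq: "sqrt (a r \<bullet> a r) = norm (a r)" for r by (rule norm_eq_sqrt_inner[symmetric])
  have "((\<lambda>r. sqrt (a r \<bullet> a r)) has_real_derivative (inverse (sqrt (a t \<bullet> a t)) / 2) * (2 * (a t \<bullet> a'))) (at t)"
    by (rule DERIV_chain2[OF DERIV_real_sqrt[OF pos] d])
  moreover have "(inverse (sqrt (a t \<bullet> a t)) / 2) * (2 * (a t \<bullet> a')) = (a t \<bullet> a') / norm (a t)"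
    unfolding sq divide_inverse by algebra
  ultimately have "((\<lambda>r. norm (a r)) has_real_derivative (a t \<bullet> a') / norm (a t)) (at t)"
    unfolding sq by (simp only:)
  then have "(geodesic_curvature_fun \<iota> \<gamma> has_real_derivative (a t \<bullet> a') / norm (a t)) (at t)"
    by (rule has_field_derivative_transform_within_open[OF _ I \<gamma>(2)])
      (simp only: geodesic_curvature_fun_def a)
  then show "(geodesic_curvature_fun \<iota> \<gamma> has_real_derivative
      (sff \<iota> (\<gamma> t) x x \<bullet> cov_sff \<iota> (\<gamma> t) x x x) / geodesic_curvature_fun \<iota> \<gamma> t) (at t)"
    unfolding in' by (simp add: geodesic_curvature_fun_def at x_def)
qed

lemma torsion_in_frame:
  assumes c: "smooth_curve \<iota> I c" "t \<in> I"
  defines "v \<equiv> vel (\<iota> \<circ> c)"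
  assumes perp: "v t \<bullet> f = 0" "v t \<bullet> h = 0"
  shows "torsion (\<lambda>t. frame_coords e f h (\<iota> (c t) - k)) t =
    ((vel v t \<bullet> f) * (vel (vel v) t \<bullet> h) - (vel v t \<bullet> h) * (vel (vel v) t \<bullet> f))
    / ((v t \<bullet> e) * ((vel v t \<bullet> f)\<^sup>2 + (vel v t \<bullet> h)\<^sup>2))"
proof -
  let ?L = "frame_coords e f h" and ?F = "\<lambda>t. frame_coords e f h (\<iota> (c t) - k)"
  have I: "open I" using c(1) unfolding smooth_curve_def by blast
  note L = bounded_linear_frame_coords[of e f h] and D = smooth_curveD[OF c(1)]
  have 1: "vel ?F s = ?L (v s)" if "s \<in> I" for s
    unfolding v_def by (rule vel_affine[OF L I that D(2)[OF that], of _ k]) simp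
  have 2: "vel (vel ?F) s = ?L (vel v s)" if "s \<in> I" for s
    unfolding v_def by (rule vel_affine[OF L I that D(3)[OF that], of _ 0]) (simp add: 1 v_def)
  have 3: "vel (vel (vel ?F)) s = ?L (vel (vel v) s)" if "s \<in> I" for s
    unfolding v_def by (rule vel_affine[OF L I that D(4)[OF that], of _ 0]) (simp add: 2 v_def)
  have cr: "cross3 (?L (v t)) (?L (vel v t)) =
      vector [0, - ((v t \<bullet> e) * (vel v t \<bullet> h)), (v t \<bullet> e) * (vel v t \<bullet> f)]"
    by (simp add: cross3_def frame_coords_def perp vec_eq_iff forall_3)
  have "cross3 (?L (v t)) (?L (vel v t)) \<bullet> ?L (vel (vel v) t) = (v t \<bullet> e) *
      ((vel v t \<bullet> f) * (vel (vel v) t \<bullet> h) - (vel v t \<bullet> h) * (vel (vel v) t \<bullet> f))"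
    unfolding cr by (simp add: inner_vec_def sum_3 frame_coords_def algebra_simps)
  moreover have "(norm (cross3 (?L (v t)) (?L (vel v t))))\<^sup>2 =
      (v t \<bullet> e) * ((v t \<bullet> e) * ((vel v t \<bullet> f)\<^sup>2 + (vel v t \<bullet> h)\<^sup>2))"
    unfolding cr power2_norm_eq_inner
    by (simp add: inner_vec_def sum_3 power2_eq_square algebra_simps)
  ultimately show ?thesis
    unfolding torsion_def 1[OF c(2)] 2[OF c(2)] 3[OF c(2)] by simp
qed

text \<open>
  At \<open>m\<close> the velocity of the normal section and the tangent part of its acceleration are orthogonal to \<open>J x\<close>,
  as all chords from \<open>m\<close> are; so they are \<open>r x\<close> and \<open>s x\<close>. Then the normal parts of the second and third
  derivatives are \<open>r\<^sup>2 b\<close> and \<open>r\<^sup>3 B + 3 r s b\<close>. The term with \<open>s\<close> is parallel to \<open>b\<close>, hence orthogonal to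
  \<open>J b\<close>, and the powers of \<open>r\<close> cancel: this is the independence of the parametrization.
\<close>

lemma normal_section_torsion:
  assumes x: "x \<in> T m" "norm x = 1"
    and J: "linear J" "quarter_turn_on (T m) J" "quarter_turn_on (N m) J"
    and b: "sff \<iota> m x x \<noteq> 0" and \<tau>: "is_normal_torsion \<iota> J m x \<tau>"
  shows "\<tau> = (J (sff \<iota> m x x) \<bullet> cov_sff \<iota> m x x x) / (sff \<iota> m x x \<bullet> sff \<iota> m x x)"
proof -
  let ?b = "sff \<iota> m x x" and ?B = "cov_sff \<iota> m x x x"
  obtain I \<mu> w where \<mu>: "normal_section_param \<iota> m x I \<mu>" and w: "w \<in> N m" "norm w = 1"
    and \<tau>_eq: "\<tau> = torsion (\<lambda>t. frame_coords x w (J w) (\<iota> (\<mu> t) - \<iota> m)) 0"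
    using \<tau> unfolding is_normal_torsion_def by blast
  let ?v = "vel (\<iota> \<circ> \<mu>)"
  have c: "smooth_curve \<iota> I \<mu>" and reg: "?v 0 \<noteq> 0" and I0: "0 \<in> I" and \<mu>0: "\<mu> 0 = m"
    and inV: "\<And>t. t \<in> I \<Longrightarrow> \<iota> (\<mu> t) - \<iota> m \<in> span (insert x (N m))"
    using \<mu> unfolding normal_section_param_def by blast+
  have I: "open I" using c unfolding smooth_curve_def by blast
  note D = smooth_curveD[OF c I0, unfolded \<mu>0]
  have xx: "x \<bullet> x = 1" using x(2) by (simp add: dot_square_norm)
  have Jx: "J x \<in> T m" "norm (J x) = 1" "x \<bullet> J x = 0"
    using J(2) x unfolding quarter_turn_on_def by auto
  have Jw: "J w \<in> N m" "norm (J w) = 1" "w \<bullet> J w = 0"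
    using J(3) w unfolding quarter_turn_on_def by auto
  have nz: "x \<noteq> 0" "J x \<noteq> 0" "w \<noteq> 0" "J w \<noteq> 0" using x(2) Jx(2) w(2) Jw(2) by auto
  have flat: "J x \<bullet> (\<iota> (\<mu> t) - \<iota> m) = 0" if "t \<in> I" for t
  proof -
    have "insert x (N m) \<subseteq> {y. J x \<bullet> y = 0}"
      using Jx T_N_orthogonal[OF Jx(1)] by (auto simp: inner_commute[of "J x" x])
    from span_minimal[OF this subspace_hyperplane] inV[OF that] show ?thesis by blast
  qed
  \<comment> \<open>\<open>J x\<close> is orthogonal to the 3-space of the section, so all derivatives of the curve are orthogonal to it\<close>
  have bl: "bounded_linear (\<lambda>y. J x \<bullet> y)" by (rule bounded_linear_inner_right)
  have flat1: "J x \<bullet> ?v t = 0" if "t \<in> I" for t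
    using vel_affine[OF bl I that smooth_curveD(2)[OF c that], of "\<lambda>_. 0" "\<iota> m"] flat by simp
  have flat2: "J x \<bullet> vel ?v t = 0" if "t \<in> I" for t
    using vel_affine[OF bl I that smooth_curveD(3)[OF c that], of "\<lambda>_. 0" 0] flat1 by simp
  have multiple: "\<exists>s. y = s *\<^sub>R x" if "y \<in> T m" "J x \<bullet> y = 0" for y
  proof
    show "y = (y \<bullet> x / (x \<bullet> x)) *\<^sub>R x"
      using plane_expansion[OF tangent_plane_subspace(2)[OF imm] x(1) Jx(1) nz(1,2) Jx(3) that(1)] that(2)
      by (simp add: inner_commute[of y "J x"])
  qed
  obtain r where r: "?v 0 = r *\<^sub>R x" using multiple[OF D(5)] flat1[OF I0] by blast
  have "r \<noteq> 0" using reg r by auto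
  have "J x \<bullet> tng m (vel ?v 0) = 0"
    unfolding inner_tan_part[OF Jx(1)] by (rule flat2[OF I0])
  then obtain s where s: "tng m (vel ?v 0) = s *\<^sub>R x" using multiple[OF tan_in] by blast
  have bx: "II m x x = ?b" using II_eq_sff[OF x(1) x(1)] .
  have acc: "nor m (vel ?v 0) = r\<^sup>2 *\<^sub>R ?b"
    using nor_acceleration[OF c I0] unfolding \<mu>0 r
    by (simp add: linear_cmul[OF linear_II_left] linear_cmul[OF linear_II_right] bx power2_eq_square)
  have "II m (vel ?v 0) y = II m (s *\<^sub>R x) y" "II m y (vel ?v 0) = II m y (s *\<^sub>R x)" for y
    unfolding II_def s[symmetric] by simp_all
  then have jerk: "nor m (vel (vel ?v) 0) = r ^ 3 *\<^sub>R ?B + (3 * r * s) *\<^sub>R ?b"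
    using nor_jerk[OF c I0] unfolding \<mu>0 r cov_sff_scaleR[OF x(1)]
    by (simp add: linear_cmul[OF linear_II_left] linear_cmul[OF linear_II_right] bx mult.assoc
        flip: scaleR_add_left)
  note dot_nor = inner_nor_part[symmetric]
  have bN: "?b \<in> N m" using sff_normal[OF x(1) x(1)] .
  have JbN: "J ?b \<in> N m" "?b \<bullet> J ?b = 0" using J(3) bN unfolding quarter_turn_on_def by blast+
  have ww: "w \<bullet> w = 1" "J w \<bullet> J w = 1" using w(2) Jw(2) by (simp_all add: dot_square_norm)
  have b_exp: "?b = (?b \<bullet> w) *\<^sub>R w + (?b \<bullet> J w) *\<^sub>R J w"
    using plane_expansion[OF dim_normal_plane w(1) Jw(1) nz(3,4) Jw(3) bN] unfolding ww div_by_1 by (rule sym)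
  have "J ?b = J ((?b \<bullet> w) *\<^sub>R w + (?b \<bullet> J w) *\<^sub>R J w)" by (rule arg_cong[OF b_exp])
  also have "\<dots> = (?b \<bullet> w) *\<^sub>R J w - (?b \<bullet> J w) *\<^sub>R w"
    by (simp add: linear_add[OF J(1)] linear_cmul[OF J(1)]
        quarter_turn_square[OF J(1,3) subspace_N dim_normal_plane w])
  finally have Jb: "y \<bullet> J ?b = (?b \<bullet> w) * (y \<bullet> J w) - (?b \<bullet> J w) * (y \<bullet> w)" for y
    by (simp add: inner_diff_right)
  have "?b \<bullet> ?b = ?b \<bullet> ((?b \<bullet> w) *\<^sub>R w + (?b \<bullet> J w) *\<^sub>R J w)" by (rule arg_cong[OF b_exp])
  then have bb: "?b \<bullet> ?b = (?b \<bullet> w)\<^sup>2 + (?b \<bullet> J w)\<^sup>2"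
    by (simp only: inner_add_right inner_scaleR_right power2_eq_square)
  have bb_nz: "?b \<bullet> ?b \<noteq> 0" using b by simp
  have "vel ?v 0 \<bullet> w = r\<^sup>2 * (?b \<bullet> w)" "vel ?v 0 \<bullet> J w = r\<^sup>2 * (?b \<bullet> J w)"
    using dot_nor[OF w(1), of "vel ?v 0"] dot_nor[OF Jw(1), of "vel ?v 0"] by (simp_all add: acc)
  moreover have "?v 0 \<bullet> x = r" "?v 0 \<bullet> w = 0" "?v 0 \<bullet> J w = 0"
    using T_N_orthogonal[OF x(1)] w(1) Jw(1) by (simp_all add: r xx)
  ultimately have "\<tau> = (r\<^sup>2 * (vel (vel ?v) 0 \<bullet> J ?b)) / (r * (r ^ 4 * (?b \<bullet> ?b)))"
    unfolding \<tau>_eq bb Jb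
    by (subst torsion_in_frame[OF c I0]) (simp_all add: algebra_simps power2_eq_square power4_eq_xxxx)
  also have "vel (vel ?v) 0 \<bullet> J ?b = r ^ 3 * (?B \<bullet> J ?b)"
    using dot_nor[OF JbN(1), of "vel (vel ?v) 0"] by (simp add: jerk inner_add_left JbN(2))
  also have "(r\<^sup>2 * (r ^ 3 * (?B \<bullet> J ?b))) / (r * (r ^ 4 * (?b \<bullet> ?b))) = (?B \<bullet> J ?b) / (?b \<bullet> ?b)"
    using \<open>r \<noteq> 0\<close> bb_nz by (simp add: field_simps power2_eq_square power3_eq_cube power4_eq_xxxx)
  finally show ?thesis by (simp add: inner_commute)
qed

end

theorem mainTheorem8:
  fixes \<iota> :: "'a::{t2_space,second_countable_topology} \<Rightarrow> real^4"
    and m :: 'a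
    and x b c n1 n2 :: "real^4"
    and J :: "real^4 \<Rightarrow> real^4"
    and I :: "real set" and \<gamma> :: "real \<Rightarrow> 'a"
    and \<kappa> \<kappa>' \<tau> :: real
  assumes "immersed_surface \<iota>"
    and "x \<in> tangent_plane \<iota> m" and "norm x = 1"
    and "linear J"
    and "quarter_turn_on (tangent_plane \<iota> m) J"
    and "quarter_turn_on (normal_plane \<iota> m) J"
    and "orthonormal_basis_of_plane (normal_plane \<iota> m) n1 n2"
    and "geodesic \<iota> I \<gamma>" and "0 \<in> I" and "\<gamma> 0 = m" and "vel (\<iota> \<circ> \<gamma>) 0 = x"
    and "\<kappa> = geodesic_curvature_fun \<iota> \<gamma> 0"
    and "\<kappa>' = deriv (geodesic_curvature_fun \<iota> \<gamma>) 0"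
    and "is_normal_torsion \<iota> J m x \<tau>"
    and "b = sff \<iota> m x x"
    and "c = sff \<iota> m x (J x)"
    and "plane_det n1 n2 c (cov_sff \<iota> m x x x) = 0"
    and "b \<noteq> 0" and "J b \<bullet> c \<noteq> 0" and "\<kappa>' \<noteq> 0"
  shows "\<tau> \<noteq> 0 \<and>
    (\<forall>u. determines_rib_direction \<iota> m u x \<longleftrightarrow>
       u = (1 / \<kappa>\<^sup>2) *\<^sub>R b - (\<kappa>' / (\<kappa>^3 * \<tau>)) *\<^sub>R J b)"
proof -
  interpret surface \<iota> by (rule surface.intro) (rule assms(1))
  define B where "B = cov_sff \<iota> m x x x"
  note x = assms(2,3) and J = assms(4-6)
  have Jx: "J x \<in> tangent_plane \<iota> m" using J(2) x(1) unfolding quarter_turn_on_def by blast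
  have bN: "b \<in> normal_plane \<iota> m" and cN: "c \<in> normal_plane \<iota> m" and BN: "B \<in> normal_plane \<iota> m"
    unfolding assms(15,16) B_def using x(1) Jx by (simp_all add: sff_normal cov_sff_normal)
  have JbN: "J b \<in> normal_plane \<iota> m" and Jb: "norm (J b) = norm b" "b \<bullet> J b = 0"
    using J(3) bN unfolding quarter_turn_on_def by auto
  have Jb_nz: "J b \<noteq> 0" using Jb(1) assms(18) by auto
  have \<kappa>: "\<kappa> = norm b" unfolding assms(12,15) geodesic_curvature_fun_def assms(10,11) ..
  have \<kappa>_nz: "\<kappa> \<noteq> 0" using assms(18) by (simp add: \<kappa>)
  have bb: "b \<bullet> b = \<kappa>\<^sup>2" "J b \<bullet> J b = \<kappa>\<^sup>2" by (simp_all add: \<kappa> Jb(1) dot_square_norm)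
  have \<kappa>': "\<kappa>' = (b \<bullet> B) / \<kappa>"
    unfolding assms(12,13,15) B_def
    by (rule geodesic_curvature_deriv[OF assms(8,9), unfolded assms(10,11)])
      (use assms(15,18) in simp)
  have \<tau>: "\<tau> = (J b \<bullet> B) / \<kappa>\<^sup>2"
    unfolding bb(1)[symmetric] B_def assms(15)
    by (rule normal_section_torsion[OF x J _ assms(14)]) (use assms(15,18) in simp)
  have "c \<noteq> 0" using assms(19) by auto
  then obtain l where l: "B = l *\<^sub>R c"
    using plane_det_0_imp_parallel[OF dim_normal_plane assms(7) cN BN] assms(17) unfolding B_def by blast
  have "l \<noteq> 0" using assms(20) by (auto simp: \<kappa>' l)
  have \<tau>_nz: "\<tau> \<noteq> 0" using \<open>l \<noteq> 0\<close> assms(19) \<kappa>_nz by (simp add: \<tau> l)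
  have coeff: "\<kappa>' / (\<kappa>^3 * \<tau>) = (b \<bullet> c) / (\<kappa>\<^sup>2 * (J b \<bullet> c))"
    using \<open>l \<noteq> 0\<close> assms(19) \<kappa>_nz
    by (simp add: \<kappa>' \<tau> l field_simps power2_eq_square power3_eq_cube)
  have "determines_rib_direction \<iota> m u x \<longleftrightarrow> u \<in> normal_plane \<iota> m \<and> u \<bullet> b = 1 \<and> u \<bullet> c = 0" for u
    using rib_direction_iff[OF x J(2), of u] unfolding assms(15,16)[symmetric] B_def[symmetric] l by auto
  moreover have "u \<in> normal_plane \<iota> m \<and> u \<bullet> b = 1 \<and> u \<bullet> c = 0 \<longleftrightarrow>
      u = (1 / \<kappa>\<^sup>2) *\<^sub>R b - ((b \<bullet> c) / (\<kappa>\<^sup>2 * (J b \<bullet> c))) *\<^sub>R J b" for u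
  proof
    assume u: "u \<in> normal_plane \<iota> m \<and> u \<bullet> b = 1 \<and> u \<bullet> c = 0"
    define k where "k = (u \<bullet> J b) / \<kappa>\<^sup>2"
    have e: "(1 / \<kappa>\<^sup>2) *\<^sub>R b + k *\<^sub>R J b = u"
      using plane_expansion[OF dim_normal_plane bN JbN assms(18) Jb_nz Jb(2), of u] u
      by (simp add: bb k_def)
    have "u \<bullet> c = (b \<bullet> c) / \<kappa>\<^sup>2 + k * (J b \<bullet> c)"
      unfolding e[symmetric] by (simp add: inner_add_left)
    then have "k = - ((b \<bullet> c) / (\<kappa>\<^sup>2 * (J b \<bullet> c)))"
      using u assms(19) \<kappa>_nz by (simp add: field_simps)
    with e show "u = (1 / \<kappa>\<^sup>2) *\<^sub>R b - ((b \<bullet> c) / (\<kappa>\<^sup>2 * (J b \<bullet> c))) *\<^sub>R J b" by simp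
  next
    assume u: "u = (1 / \<kappa>\<^sup>2) *\<^sub>R b - ((b \<bullet> c) / (\<kappa>\<^sup>2 * (J b \<bullet> c))) *\<^sub>R J b"
    have "u \<in> normal_plane \<iota> m"
      unfolding u by (intro subspace_diff[OF subspace_N] subspace_scale[OF subspace_N] bN JbN)
    moreover have "u \<bullet> b = 1"
      unfolding u using \<kappa>_nz by (simp add: inner_diff_left bb Jb(2) inner_commute[of "J b" b])
    moreover have "u \<bullet> c = 0"
      unfolding u using \<kappa>_nz assms(19) by (simp add: inner_diff_left field_simps)
    ultimately show "u \<in> normal_plane \<iota> m \<and> u \<bullet> b = 1 \<and> u \<bullet> c = 0" by blast
  qed
  ultimately show ?thesis using \<tau>_nz unfolding coeff by blast
qed

end
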